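(* Let $w\in\mathcal S_n$. Then $$\mathcal H_w(x;y)=\sum_{\gamma}(-1)^{\ell(\gamma)-m(\gamma)}\,\frac{\mathcal H_{\omega_0}(x;y)}{\mu_{x,y}(\gamma)},$$ the sum over all climbing chains from $w$ to $\omega_0$ in the Bruhat order on $\mathcal S_n$ equipped with an $\mathcal H$-marking (that is, over all pairs consisting of a climbing chain and an $\mathcal H$-marking of it, as defined in the context).
   Context: Permutations are written in one-line notation, products are compositions $(uv)(i)=u(v(i))$, $s_i$ is the transposition of $i,i+1$, $t_{a,b}$ ($a<b$) the transposition of $a,b$, $\ell(w)$ the number of inversions, $\omega_0=[n,n-1,\dots,1]$. Double $\mathcal H$-polynomials (for fixed $n$): $s_i$ acts on polynomials in $x_1,\dots,x_n,y_1,\dots,y_n$ by exchanging $x_i,x_{i+1}$. Let $\pi_i f=\dfrac{(1-x_{i+1})f-s_i((1-x_{i+1})f)}{x_i-x_{i+1}}$, $\mu_i=\pi_i-1$, and $\mu_v=\mu_{i_1}\cdots\mu_{i_r}$ for any reduced word $v=s_{i_1}\cdots s_{i_r}$. Then $\mathcal H_{\omega_0}(x;y)=\prod_{i+j\le n}(x_i+y_j-x_iy_j)$ and $\mathcal H_w(x;y)=\mu_{w^{-1}\omega_0}\mathcal H_{\omega_0}(x;y)$ for $w\in\mathcal S_n$. Chains: for $1\le k<n$, a cover in the $k$-Bruhat order on $\mathcal S_n$ is $u\xrightarrow{(a,b)}u\,t_{a,b}$ with $a\le k<b$ and $\ell(u\,t_{a,b})=\ell(u)+1$; a chain is a (possibly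 empty) sequence of successive covers. A climbing chain from $w$ to $\omega_0$ is a concatenation, in this order, of chains in the $1$-, $2$-, $\dots$, $(n-1)$-Bruhat orders (some possibly empty), starting at $w$ and ending at $\omega_0$, such that the permutation at the end of the chain in the $k$-Bruhat order has the form $[n,n-1,\dots,n-k+1,\dots]$. (All covers in the segment in the $k$-Bruhat order then have labels of the form $(k,b)$.) An $\mathcal H$-marking of a climbing chain is a choice of a set of marked covers such that, when each segment in a given $k$-Bruhat order is cut at the permutations before each marked cover, it decomposes into decreasing segments; equivalently, a cover labeled $(k,j)$ has to be marked if it is immediately preceded by one labeled $(k,i)$ with $i>j$, and any other cover may be marked or not. $\ell(\gamma)$ is the number of covers and $m(\gamma)$ the number of marked covers. For a cover $u\lessdot v$ set $t_{i,k}=u^{-1}v$ and $t_{j,l}=vu^{-1}$ with $i<k$ and $j<l$; $\mu_{x,y}(\gamma)=\prod(x_i+y_j-x_iy_j)$, the product taken over all marked covers in $\gamma$. *)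

theory Defs
  imports
    "HOL-Library.Poly_Mapping"
    "HOL-Computational_Algebra.Fraction_Field"
    "HOL-Combinatorics.Permutations"
begin

section \<open>Polynomials in the variables x and y\<close>

text \<open>
  Polynomials are finitely supported maps from monomials (exponent vectors) to integer
  coefficients. The linear order on variables has no mathematical significance; it is only needed
  for the library to recognise the polynomial ring as an integral domain.
\<close>

datatype var = X nat | Y nat

instantiation var :: linorder
begin

fun less_eq_var :: "var \<Rightarrow> var \<Rightarrow> bool" where
  "X i \<le> X j \<longleftrightarrow> i \<le> j"
| "X i \<le> Y j \<longleftrightarrow> True"
| "Y i \<le> X j \<longleftrightarrow> False"
| "Y i \<le> Y j \<longleftrightarrow> i \<le> j"

definition less_var :: "var \<Rightarrow> var \<Rightarrow> bool" where
  "less_var u v \<longleftrightarrow> u \<le> v \<and> \<not> v \<le> u"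

instance
proof
  fix u v w :: var
  show "u < v \<longleftrightarrow> u \<le> v \<and> \<not> v \<le> u" by (rule less_var_def)
  show "u \<le> u" by (cases u) auto
  show "u \<le> v \<Longrightarrow> v \<le> w \<Longrightarrow> u \<le> w" by (cases u; cases v; cases w) auto
  show "u \<le> v \<Longrightarrow> v \<le> u \<Longrightarrow> u = v" by (cases u; cases v) auto
  show "u \<le> v \<or> v \<le> u" by (cases u; cases v) auto
qed

end

type_synonym xypoly = "(var \<Rightarrow>\<^sub>0 nat) \<Rightarrow>\<^sub>0 int"

definition indet :: "var \<Rightarrow> xypoly" where
  "indet v = Poly_Mapping.single (Poly_Mapping.single v 1) 1"

abbreviation vx :: "nat \<Rightarrow> xypoly" where "vx i \<equiv> indet (X i)"
abbreviation vy :: "nat \<Rightarrow> xypoly" where "vy j \<equiv> indet (Y j)"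

text \<open>
  The action of the transposition \<open>s\<^sub>i\<close> on polynomials: the coefficient of a monomial in the
  image is the coefficient in \<open>f\<close> of that monomial with the exponents of \<open>x\<^sub>i\<close> and
  \<open>x\<^sub>i\<^sub>+\<^sub>1\<close> exchanged.
\<close>

definition swap_x :: "nat \<Rightarrow> xypoly \<Rightarrow> xypoly" where
  "swap_x i = Poly_Mapping.map_key (Poly_Mapping.map_key (transpose (X i) (X (Suc i))))"

lemma inj_map_key_transpose: "inj (Poly_Mapping.map_key (transpose (u :: 'a) v) :: ('a \<Rightarrow>\<^sub>0 nat) \<Rightarrow> _)"
proof (rule inj_on_inverseI[where g = "Poly_Mapping.map_key (transpose u v)"])
  fix m :: "'a \<Rightarrow>\<^sub>0 nat"
  show "Poly_Mapping.map_key (transpose u v) (Poly_Mapping.map_key (transpose u v) m) = m"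
    by (simp add: map_key_compose map_key_id[unfolded id_def[symmetric]])
qed

lemma swap_x_indet: "swap_x i (indet v) = indet (transpose (X i) (X (Suc i)) v)"
proof -
  let ?t = "transpose (X i) (X (Suc i))"
  have *: "Poly_Mapping.map_key ?t (Poly_Mapping.single u k) = Poly_Mapping.single (?t u) k"
    for u and k :: nat
    using map_key_single[of ?t "?t u" k] by simp
  show ?thesis
    using map_key_single[OF inj_map_key_transpose[of "X i" "X (Suc i)"],
        of "Poly_Mapping.single (?t v) 1" "1 :: int"]
    unfolding swap_x_def indet_def by (simp add: *)
qed

text \<open>Exact division; the quotient, if it exists, is unique for a nonzero divisor.\<close>

definition exact_div :: "xypoly \<Rightarrow> xypoly \<Rightarrow> xypoly" where
  "exact_div f g = (THE q. f = q * g)"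

lemma exact_div_eqI: "exact_div (q * g) g = q" if "g \<noteq> 0"
  using that by (auto simp: exact_div_def)


section \<open>Permutations\<close>

text \<open>
  The symmetric group on \<open>{1..n}\<close> consists of the functions \<open>w\<close> with \<open>w permutes {1..n}\<close>
  (in particular fixing everything else).
\<close>

definition len :: "(nat \<Rightarrow> nat) \<Rightarrow> nat" where
  "len w = card {(i, j). i < j \<and> w j < w i}"

definition w0 :: "nat \<Rightarrow> nat \<Rightarrow> nat" where
  "w0 n i = (if i \<in> {1..n} then n + 1 - i else i)"

definition word_prod :: "nat list \<Rightarrow> nat \<Rightarrow> nat" where
  "word_prod is = foldr (\<lambda>i v. transpose i (Suc i) \<circ> v) is id"

definition reduced_word :: "nat \<Rightarrow> nat list \<Rightarrow> (nat \<Rightarrow> nat) \<Rightarrow> bool" where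
  "reduced_word n is v \<longleftrightarrow> set is \<subseteq> {1..<n} \<and> word_prod is = v \<and> length is = len v"


section \<open>Double H-polynomials\<close>

definition pi_op :: "nat \<Rightarrow> xypoly \<Rightarrow> xypoly" where
  "pi_op i f =
     exact_div ((1 - vx (Suc i)) * f - swap_x i ((1 - vx (Suc i)) * f)) (vx i - vx (Suc i))"

definition mu_op :: "nat \<Rightarrow> xypoly \<Rightarrow> xypoly" where
  "mu_op i f = pi_op i f - f"

definition mu_word :: "nat list \<Rightarrow> xypoly \<Rightarrow> xypoly" where
  "mu_word is = foldr mu_op is"

text \<open>The choice of the reduced word is immaterial, since the \<open>mu_op i\<close> satisfy the braid relations.\<close>

definition mu_perm :: "nat \<Rightarrow> (nat \<Rightarrow> nat) \<Rightarrow> xypoly \<Rightarrow> xypoly" where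
  "mu_perm n v = mu_word (SOME is. reduced_word n is v)"

definition H_top :: "nat \<Rightarrow> xypoly" where
  "H_top n = (\<Prod>(i, j) | 1 \<le> i \<and> 1 \<le> j \<and> i + j \<le> n. vx i + vy j - vx i * vy j)"

definition H_poly :: "nat \<Rightarrow> (nat \<Rightarrow> nat) \<Rightarrow> xypoly" where
  "H_poly n w = mu_perm n (inv w \<circ> w0 n) (H_top n)"


section \<open>Climbing chains and markings\<close>

definition k_cover :: "nat \<Rightarrow> nat \<Rightarrow> (nat \<Rightarrow> nat) \<Rightarrow> (nat \<Rightarrow> nat) \<Rightarrow> bool" where
  "k_cover n k u v \<longleftrightarrow>
     (\<exists>a b. 1 \<le> a \<and> a \<le> k \<and> k < b \<and> b \<le> n \<and> v = u \<circ> transpose a b \<and> len v = len u + 1)"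

text \<open>
  A chain is given by the list \<open>\<gamma>\<close> of permutations it visits; its covers are the pairs
  \<open>\<gamma> ! m\<close>, \<open>\<gamma> ! Suc m\<close>, and the \<open>m\<close>-th cover refers to this pair. In a climbing chain,
  \<open>p k\<close> is the position in \<open>\<gamma>\<close> at which the segment in the \<open>k\<close>-Bruhat order ends.
\<close>

definition climbing_chain :: "nat \<Rightarrow> (nat \<Rightarrow> nat) \<Rightarrow> (nat \<Rightarrow> nat) list \<Rightarrow> bool" where
  "climbing_chain n w \<gamma> \<longleftrightarrow> \<gamma> \<noteq> [] \<and> hd \<gamma> = w \<and> last \<gamma> = w0 n \<and>
     (\<exists>p. p 0 = 0 \<and> p (n - 1) = length \<gamma> - 1 \<and>
        (\<forall>k\<in>{1..<n}. p (k - 1) \<le> p k \<and>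
           (\<forall>m\<in>{p (k - 1)..<p k}. k_cover n k (\<gamma> ! m) (\<gamma> ! Suc m)) \<and>
           (\<forall>i\<in>{1..k}. (\<gamma> ! p k) i = n + 1 - i)))"

definition num_covers :: "(nat \<Rightarrow> nat) list \<Rightarrow> nat" where
  "num_covers \<gamma> = length \<gamma> - 1"

text \<open>The pair \<open>(a, b)\<close> with \<open>a < b\<close> of points exchanged by a transposition.\<close>

definition moved :: "(nat \<Rightarrow> nat) \<Rightarrow> nat \<times> nat" where
  "moved t = (THE (a, b). a < b \<and> t = transpose a b)"

definition label :: "(nat \<Rightarrow> nat) list \<Rightarrow> nat \<Rightarrow> nat \<times> nat" where
  "label \<gamma> m = moved (inv (\<gamma> ! m) \<circ> \<gamma> ! Suc m)"

definition value_label :: "(nat \<Rightarrow> nat) list \<Rightarrow> nat \<Rightarrow> nat \<times> nat" where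
  "value_label \<gamma> m = moved (\<gamma> ! Suc m \<circ> inv (\<gamma> ! m))"

text \<open>
  A marking is the set \<open>M\<close> of indices of the marked covers. Two consecutive covers of a climbing
  chain lie in the same segment iff their labels have the same first component.
\<close>

definition H_marking :: "(nat \<Rightarrow> nat) list \<Rightarrow> nat set \<Rightarrow> bool" where
  "H_marking \<gamma> M \<longleftrightarrow> M \<subseteq> {..<num_covers \<gamma>} \<and>
     (\<forall>m k i j. Suc m < num_covers \<gamma> \<and> label \<gamma> m = (k, i) \<and> label \<gamma> (Suc m) = (k, j) \<and> i > j
        \<longrightarrow> Suc m \<in> M)"

definition mu_weight :: "(nat \<Rightarrow> nat) list \<Rightarrow> nat set \<Rightarrow> xypoly" where
  "mu_weight \<gamma> M =
     (\<Prod>m\<in>M. let i = fst (label \<gamma> m); j = fst (value_label \<gamma> m) in vx i + vy j - vx i * vy j)"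

definition ratfun :: "xypoly \<Rightarrow> xypoly fract" where
  "ratfun f = Fract f 1"

end

theory Submission
  imports Defs
begin

text \<open>
  Put \<open>X\<^sub>i = 1 - x\<^sub>i\<close> and \<open>Y\<^sub>j = 1 - y\<^sub>j\<close>, so that
  \<open>x\<^sub>i + y\<^sub>j - x\<^sub>i y\<^sub>j = 1 - X\<^sub>i Y\<^sub>j\<close>, and write \<open>C w\<close> for the right-hand side of the
  formula. In the field of rational functions the operators become
  \<open>\<mu>\<^sub>i f = X\<^sub>i (f - s\<^sub>i f) / (X\<^sub>i\<^sub>+\<^sub>1 - X\<^sub>i)\<close>.

  For a fixed chain the sum over its markings factors: a marked cover contributes
  \<open>1 / (1 - X\<^sub>k Y\<^sub>a)\<close>, an unmarked one \<open>-1\<close>, and only the covers at a descent of labels have no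
  choice (\<open>sum_markings\<close>). Splitting off the first cover then turns the chain sum into a Monk-type
  recursion (\<open>climbing_sum_monk\<close>): if \<open>k\<close> is the first position with \<open>w k \<noteq> n + 1 - k\<close>, then
  \<open>C w = X\<^sub>k Y\<^sub>a (\<Sum> C z)\<close>, where \<open>a = w k\<close> and \<open>z\<close> runs over the ends of all chains of covers of label
  \<open>(k, b)\<close> from \<open>w\<close>, possibly empty, along which \<open>b\<close> decreases. As \<open>X\<^sub>k Y\<^sub>a \<noteq> 1\<close>, the recursion
  expresses \<open>C w\<close> through longer permutations.

  It remains to see that the recursion forces \<open>C w = \<mu>\<^sub>i (C (w s\<^sub>i))\<close> at every ascent \<open>i\<close> of \<open>w\<close>
  (\<open>mu_rat_of_monk_recursion\<close>); then \<open>C\<close> is computed by an arbitrary reduced word, and since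
  \<open>C \<omega>\<^sub>0\<close> is the top polynomial, \<open>C w = H\<^sub>w\<close>. The proof is by downward induction on the length.

  \<^item> For \<open>i > k\<close>, the operator \<open>\<mu>\<^sub>i\<close> commutes with \<open>X\<^sub>k\<close>, and the sum over chains with decreasing
    labels commutes with the action of the 0-Hecke algebra on positions greater than \<open>k\<close>
    (\<open>descending_sum_hecke\<close>).
  \<^item> For \<open>i = k\<close>, if \<open>w\<close> has another ascent \<open>j > k\<close>, the claim for \<open>j\<close>, the induction
    hypothesis and the braid relations of the operators give the claim for \<open>i\<close>.
  \<^item> If \<open>k\<close> is the only ascent of \<open>w\<close>, then \<open>w (k + 1)\<close> is the largest value available, so that the
    recursion at position \<open>k + 1\<close> applies to \<open>w s\<^sub>k\<close>, unless this is \<open>\<omega>\<^sub>0\<close>, where the top polynomial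
    is explicit. The relation
    \<open>\<mu>\<^sub>k X\<^sub>k\<^sub>+\<^sub>1 = X\<^sub>k (1 + \<mu>\<^sub>k)\<close> and a shift of chains from position \<open>k + 1\<close> to position \<open>k\<close>
    (\<open>descending_sum_shift\<close>) convert it into the recursion at \<open>w\<close>.
\<close>

section \<open>The action of the simple transpositions on polynomials\<close>

lemma poly_mapping_additive_induct [case_names zero single plus]:
  fixes f :: "'a \<Rightarrow>\<^sub>0 'b::monoid_add"
  assumes "P 0" and "\<And>k v. P (Poly_Mapping.single k v)" and "\<And>f g. P f \<Longrightarrow> P g \<Longrightarrow> P (f + g)"
  shows "P f"
proof (induction f rule: update_induct)
  case (update f a b)
  have "Poly_Mapping.update a b f = f + Poly_Mapping.single a b"
    using update(1)
    by (intro poly_mapping_eqI) (auto simp: lookup_update lookup_add lookup_single when_def in_keys_iff)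
  then show ?case using update assms by simp
qed (rule assms)

lemma xypoly_induct [case_names const indet plus times]:
  fixes f :: xypoly
  assumes const: "\<And>c. P (Poly_Mapping.single 0 c)" and indet: "\<And>v. P (indet v)"
    and plus: "\<And>f g. P f \<Longrightarrow> P g \<Longrightarrow> P (f + g)" and times: "\<And>f g. P f \<Longrightarrow> P g \<Longrightarrow> P (f * g)"
  shows "P f"
proof (induction f rule: poly_mapping_additive_induct)
  case zero
  then show ?case using const[of 0] by simp
next
  case (single m c)
  have var: "P (Poly_Mapping.single (Poly_Mapping.single v e) 1)" for v e
  proof (induction e)
    case 0
    then show ?case using const[of 1] by simp
  next
    case (Suc e)
    have "Poly_Mapping.single (Poly_Mapping.single v (Suc e)) 1
        = indet v * Poly_Mapping.single (Poly_Mapping.single v e) 1"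
      by (simp add: indet_def mult_single flip: single_add)
    then show ?case using times[OF indet Suc] by simp
  qed
  have monom: "P (Poly_Mapping.single m 1)"
  proof (induction m rule: poly_mapping_additive_induct)
    case zero
    then show ?case using const[of 1] by simp
  next
    case (plus f g)
    then show ?case using times[OF plus] by (simp add: mult_single)
  qed (rule var)
  show ?case using times[OF const[of c] monom] by (simp add: mult_single)
qed (rule plus)

lemma swap_x_add: "swap_x i (f + g) = swap_x i f + swap_x i g"
  unfolding swap_x_def by (rule map_key_plus[OF inj_map_key_transpose])

lemma swap_x_single:
  "swap_x i (Poly_Mapping.single m c) =
    Poly_Mapping.single (Poly_Mapping.map_key (transpose (X i) (X (Suc i))) m) c"
proof -
  let ?h = "Poly_Mapping.map_key (transpose (X i) (X (Suc i))) :: (var \<Rightarrow>\<^sub>0 nat) \<Rightarrow> _"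
  have "?h (?h m) = m"
    by (simp add: map_key_compose map_key_id[unfolded id_def[symmetric]])
  then show ?thesis
    unfolding swap_x_def using map_key_single[OF inj_map_key_transpose, of "X i" "X (Suc i)" "?h m" c] by simp
qed

lemma swap_x_mult: "swap_x i (f * g) = swap_x i f * swap_x i g"
proof (induction f rule: poly_mapping_additive_induct)
  case (single k v)
  show ?case
  proof (induction g rule: poly_mapping_additive_induct)
    case (single l w)
    then show ?case
      by (simp add: swap_x_single mult_single map_key_plus)
  qed (simp_all add: swap_x_add distrib_left, simp add: swap_x_def inj_map_key_transpose)
qed (simp_all add: swap_x_add distrib_right, simp add: swap_x_def inj_map_key_transpose)

lemma swap_x_const [simp]: "swap_x i (Poly_Mapping.single 0 c) = Poly_Mapping.single 0 c"
  by (simp add: swap_x_single)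

lemma swap_x_0 [simp]: "swap_x i 0 = 0"
  using swap_x_const[of i 0] by (simp only: single_zero)

lemma swap_x_1 [simp]: "swap_x i 1 = 1"
  using swap_x_const[of i 1] by (simp only: single_one)

lemma swap_x_uminus: "swap_x i (- f) = - swap_x i f"
  using swap_x_add[of i "- f" f] by (simp add: eq_neg_iff_add_eq_0)

lemma swap_x_diff: "swap_x i (f - g) = swap_x i f - swap_x i g"
  using swap_x_add[of i f "- g"] by (simp add: swap_x_uminus)

lemmas swap_x_hom = swap_x_add swap_x_mult swap_x_diff swap_x_uminus

lemma swap_x_involutive [simp]: "swap_x i (swap_x i f) = f"
  by (induction f rule: xypoly_induct) (simp_all add: swap_x_hom swap_x_indet)

lemma swap_x_eq_0_iff [simp]: "swap_x i f = 0 \<longleftrightarrow> f = 0"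
  by (metis swap_x_0 swap_x_involutive)

lemma swap_x_braid:
  "swap_x i (swap_x (Suc i) (swap_x i f)) = swap_x (Suc i) (swap_x i (swap_x (Suc i) f))"
proof (induction f rule: xypoly_induct)
  case (indet v)
  then show ?case
    by (auto simp: swap_x_indet transpose_def)
qed (simp_all add: swap_x_hom)

lemma swap_x_commute:
  assumes "Suc i < j"
  shows "swap_x i (swap_x j f) = swap_x j (swap_x i f)"
proof (induction f rule: xypoly_induct)
  case (indet v)
  then show ?case
    using assms by (auto simp: swap_x_indet transpose_def)
qed (simp_all add: swap_x_hom)

lemma indet_eq_iff [simp]: "indet u = indet v \<longleftrightarrow> u = v"
proof
  assume "indet u = indet v"
  then have "Poly_Mapping.keys (indet u) = Poly_Mapping.keys (indet v)" by simp
  then have "Poly_Mapping.single u (1::nat) = Poly_Mapping.single v 1"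
    by (simp add: indet_def)
  then have "Poly_Mapping.keys (Poly_Mapping.single u (1::nat)) = Poly_Mapping.keys (Poly_Mapping.single v (1::nat))"
    by simp
  then show "u = v" by simp
qed simp

text \<open>
  The divided difference is a twisted derivation, so divisibility passes from the variables to all
  polynomials. This is what makes the exact division in \<open>pi_op\<close> meaningful.
\<close>

lemma dvd_diff_swap_x: "vx i - vx (Suc i) dvd f - swap_x i f"
proof (induction f rule: xypoly_induct)
  case (indet v)
  have "vx i - vx (Suc i) dvd vx (Suc i) - vx i"
    by (metis dvd_minus_iff dvd_refl minus_diff_eq)
  then show ?case
    by (auto simp: swap_x_indet transpose_def)
next
  case (plus f g)
  then show ?case
    using dvd_add[OF plus] by (simp add: swap_x_add algebra_simps)
next
  case (times f g)
  have "f * g - swap_x i (f * g) = (f - swap_x i f) * g + swap_x i f * (g - swap_x i g)"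
    by (simp add: swap_x_mult algebra_simps)
  then show ?case using times by simp
qed simp

section \<open>The operators on rational functions\<close>

lemma ratfun_hom [simp]:
  "ratfun 0 = 0" "ratfun 1 = 1"
  "ratfun (f + g) = ratfun f + ratfun g" "ratfun (f - g) = ratfun f - ratfun g"
  "ratfun (f * g) = ratfun f * ratfun g" "ratfun (- f) = - ratfun f"
  by (simp_all add: ratfun_def Zero_fract_def One_fract_def)

lemma ratfun_eq_iff [simp]: "ratfun f = ratfun g \<longleftrightarrow> f = g"
  by (simp add: ratfun_def eq_fract)

lemma ratfun_prod: "ratfun (\<Prod>a\<in>A. f a) = (\<Prod>a\<in>A. ratfun (f a))"
  by (induction A rule: infinite_finite_induct) simp_all

text \<open>
  The extension of the action of \<open>s\<^sub>i\<close> to the fraction field. The description is unique because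
  \<open>swap_x i\<close> is an injective ring homomorphism.
\<close>

definition swap_rat :: "nat \<Rightarrow> xypoly fract \<Rightarrow> xypoly fract" where
  "swap_rat i q = (THE r. \<forall>f g. g \<noteq> 0 \<longrightarrow> q = Fract f g \<longrightarrow> r = Fract (swap_x i f) (swap_x i g))"

lemma swap_rat_Fract:
  assumes "g \<noteq> 0"
  shows "swap_rat i (Fract f g) = Fract (swap_x i f) (swap_x i g)"
proof -
  have "Fract (swap_x i f) (swap_x i g) = Fract (swap_x i f') (swap_x i g')"
    if "g' \<noteq> 0" "Fract f g = Fract f' g'" for f' g'
  proof -
    have "f * g' = f' * g" using that assms by (simp add: eq_fract)
    then have "swap_x i f * swap_x i g' = swap_x i f' * swap_x i g"
      by (simp flip: swap_x_mult)
    then show ?thesis using that assms by (simp add: eq_fract)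
  qed
  then show ?thesis
    unfolding swap_rat_def using assms by (intro the_equality) blast+
qed

lemma swap_rat_ratfun [simp]: "swap_rat i (ratfun f) = ratfun (swap_x i f)"
  by (simp add: ratfun_def swap_rat_Fract)

lemma swap_rat_add: "swap_rat i (p + q) = swap_rat i p + swap_rat i q"
  by (cases p; cases q) (simp add: swap_rat_Fract swap_x_hom)

lemma swap_rat_mult: "swap_rat i (p * q) = swap_rat i p * swap_rat i q"
  by (cases p; cases q) (simp add: swap_rat_Fract swap_x_hom)

lemma swap_rat_uminus: "swap_rat i (- p) = - swap_rat i p"
  by (cases p) (simp add: swap_rat_Fract swap_x_hom)

lemma swap_rat_diff: "swap_rat i (p - q) = swap_rat i p - swap_rat i q"
  by (cases p; cases q) (simp add: swap_rat_Fract swap_x_hom)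

lemma swap_rat_0 [simp]: "swap_rat i 0 = 0"
  using swap_rat_ratfun[of i 0] by (simp del: swap_rat_ratfun)

lemma swap_rat_1 [simp]: "swap_rat i 1 = 1"
  using swap_rat_ratfun[of i 1] by (simp del: swap_rat_ratfun)

lemma swap_rat_inverse: "swap_rat i (inverse p) = inverse (swap_rat i p)"
proof (cases "p = 0")
  case True
  then show ?thesis by simp
next
  case False
  then have "swap_rat i (inverse p) * swap_rat i p = 1"
    by (simp flip: swap_rat_mult)
  then show ?thesis
    using inverse_unique[of "swap_rat i p" "swap_rat i (inverse p)"] by (simp add: mult.commute)
qed

lemma swap_rat_divide: "swap_rat i (p / q) = swap_rat i p / swap_rat i q"
  by (simp add: divide_inverse swap_rat_mult swap_rat_inverse)

lemmas swap_rat_hom = swap_rat_add swap_rat_mult swap_rat_uminus swap_rat_diff swap_rat_inverse swap_rat_divide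

lemma swap_rat_involutive [simp]: "swap_rat i (swap_rat i p) = p"
  by (cases p) (simp add: swap_rat_Fract)

lemma swap_rat_braid: "swap_rat i (swap_rat (Suc i) (swap_rat i p)) = swap_rat (Suc i) (swap_rat i (swap_rat (Suc i) p))"
  by (cases p) (simp add: swap_rat_Fract swap_x_braid)

lemma swap_rat_commute: "Suc i < j \<Longrightarrow> swap_rat i (swap_rat j p) = swap_rat j (swap_rat i p)"
  by (cases p) (metis swap_rat_Fract swap_x_commute swap_x_eq_0_iff)

text \<open>
  The complementary variables \<open>1 - x\<^sub>i\<close> and \<open>1 - y\<^sub>j\<close>, in which the factor
  \<open>x\<^sub>i + y\<^sub>j - x\<^sub>i y\<^sub>j\<close> is \<open>1 - cx i * cy j\<close>.
\<close>

definition cx :: "nat \<Rightarrow> xypoly fract" where "cx i = 1 - ratfun (vx i)"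
definition cy :: "nat \<Rightarrow> xypoly fract" where "cy j = 1 - ratfun (vy j)"

lemma swap_rat_cx: "swap_rat i (cx j) = cx (transpose i (Suc i) j)"
  by (auto simp: cx_def swap_rat_hom swap_x_indet transpose_def)

lemma swap_rat_cy [simp]: "swap_rat i (cy j) = cy j"
  by (auto simp: cy_def swap_rat_hom swap_x_indet transpose_def)

lemma cx_eq_iff [simp]: "cx i = cx j \<longleftrightarrow> i = j"
  by (simp add: cx_def)

definition mu_rat :: "nat \<Rightarrow> xypoly fract \<Rightarrow> xypoly fract" where
  "mu_rat i f = cx i * (f - swap_rat i f) / (cx (Suc i) - cx i)"

text \<open>
  Subtracting \<open>f\<close> from \<open>\<pi>\<^sub>i f\<close> replaces \<open>cx (Suc i) * f\<close> by \<open>cx i * f\<close> in the numerator, so that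
  \<open>cx i\<close> splits off and the divided difference of \<open>f\<close> itself remains.
\<close>

lemma ratfun_mu_op: "ratfun (mu_op i f) = mu_rat i (ratfun f)"
proof -
  let ?g = "(1 - vx (Suc i)) * f" and ?d = "vx i - vx (Suc i)"
  obtain q where q: "?g - swap_x i ?g = q * ?d"
    using dvd_diff_swap_x[of i ?g] by (metis dvdE mult.commute)
  have d: "?d \<noteq> 0" by simp
  have "pi_op i f = q"
    unfolding pi_op_def q by (rule exact_div_eqI[OF d])
  moreover have "ratfun ?g - swap_rat i (ratfun ?g) = ratfun q * ratfun ?d"
    using arg_cong[OF q, of ratfun] unfolding swap_rat_ratfun ratfun_hom(4)[of ?g] ratfun_hom(5)[of q] .
  then have "cx (Suc i) * ratfun f - cx i * swap_rat i (ratfun f) = ratfun q * (cx (Suc i) - cx i)"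
    by (simp add: swap_rat_hom swap_x_hom swap_x_indet cx_def)
  then have "ratfun q = (cx (Suc i) * ratfun f - cx i * swap_rat i (ratfun f)) / (cx (Suc i) - cx i)"
    by (simp add: field_simps)
  ultimately show ?thesis
    by (simp add: mu_op_def mu_rat_def field_simps)
qed

lemma mu_rat_0 [simp]: "mu_rat i 0 = 0"
  by (simp add: mu_rat_def)

lemma mu_rat_add: "mu_rat i (f + g) = mu_rat i f + mu_rat i g"
  by (simp add: mu_rat_def swap_rat_add add_divide_distrib diff_divide_distrib algebra_simps)

lemma mu_rat_scale: "swap_rat i c = c \<Longrightarrow> mu_rat i (c * f) = c * mu_rat i f"
  by (simp add: mu_rat_def swap_rat_hom field_simps)

lemma mu_rat_mu: "mu_rat i (mu_rat i f) = - mu_rat i f"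
proof -
  have "cx (Suc i) - cx i \<noteq> 0" "cx i - cx (Suc i) \<noteq> 0" by simp_all
  then show ?thesis
    by (simp add: mu_rat_def swap_rat_hom swap_rat_cx divide_simps) algebra
qed

text \<open>
  This commutation relation moves a recursion at position \<open>i + 1\<close> to one at position \<open>i\<close>.
\<close>

lemma mu_rat_cx_Suc: "mu_rat i (cx (Suc i) * f) = cx i * (f + mu_rat i f)"
proof -
  have "cx (Suc i) - cx i \<noteq> 0" by simp
  then show ?thesis
    by (simp add: mu_rat_def swap_rat_hom swap_rat_cx divide_simps) algebra
qed

lemma mu_rat_commute:
  assumes "Suc i < j"
  shows "mu_rat i (mu_rat j f) = mu_rat j (mu_rat i f)"
proof -
  have "cx (Suc i) - cx i \<noteq> 0" "cx (Suc j) - cx j \<noteq> 0" by simp_all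
  moreover note swap_rat_commute[OF assms, of f]
  ultimately show ?thesis
    using assms by (simp add: mu_rat_def swap_rat_hom swap_rat_cx transpose_def divide_simps) (simp add: algebra_simps)
qed

lemma mu_rat_braid: "mu_rat i (mu_rat (Suc i) (mu_rat i f)) = mu_rat (Suc i) (mu_rat i (mu_rat (Suc i) f))"
proof -
  have "cx (Suc i) - cx i \<noteq> 0" "cx i - cx (Suc i) \<noteq> 0" "cx (Suc (Suc i)) - cx (Suc i) \<noteq> 0" 
     "cx (Suc i) - cx (Suc (Suc i)) \<noteq> 0" "cx (Suc (Suc i)) - cx i \<noteq> 0" "cx i - cx (Suc (Suc i)) \<noteq> 0"
    by simp_all
  then show ?thesis
    by (simp add: mu_rat_def swap_rat_hom swap_rat_cx transpose_def swap_rat_braid divide_simps) algebra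
qed

section \<open>Length and covers in the Bruhat order\<close>

lemma inversions_subset:
  assumes "w permutes {1..n::nat}"
  shows "{(i, j). i < j \<and> w j < w i} \<subseteq> {1..n} \<times> {1..n}"
proof clarify
  fix i j :: nat
  assume ij: "i < j" "w j < w i"
  have "w k = k" if "k \<notin> {1..n}" for k using assms that by (rule permutes_not_in)
  moreover have "w k \<in> {1..n}" if "k \<in> {1..n}" for k
    using that permutes_in_image[OF assms] by blast
  ultimately show "i \<in> {1..n} \<and> j \<in> {1..n}"
    using ij by (metis atLeastAtMost_iff le_trans less_imp_le not_le not_less_zero less_one)
qed

lemma finite_inversions:
  assumes "w permutes {1..n::nat}"
  shows "finite {(i, j). i < j \<and> w j < w i}"
  by (rule finite_subset[OF inversions_subset[OF assms]]) simp

text \<open>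
  Apply \<open>t = transpose a b\<close> to both positions of a pair. A pair of positions that \<open>t\<close> keeps in order
  is an inversion of \<open>u \<circ> t\<close> iff its image is one of \<open>u\<close>. The other pairs are the inversions of \<open>t\<close>,
  namely \<open>(a, b)\<close>, \<open>(a, c)\<close> and \<open>(c, b)\<close> with \<open>a < c < b\<close>, and only their contributions differ: the
  pair \<open>(a, b)\<close> adds one inversion, and each \<open>c\<close> with a value between \<open>u a\<close> and \<open>u b\<close> adds two.
\<close>

lemma len_transpose:
  fixes u :: "nat \<Rightarrow> nat"
  assumes u: "u permutes {1..n}" and ab: "a < b" "u a < u b" "a \<in> {1..n}" "b \<in> {1..n}"
  shows "len (u \<circ> transpose a b) = len u + 1 + 2 * card {c. a < c \<and> c < b \<and> u a < u c \<and> u c < u b}"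
proof -
  define t where "t = transpose a b"
  define I where "I w = {(i, j). i < j \<and> w j < w i}" for w :: "nat \<Rightarrow> nat"
  \<comment> \<open>The pairs of positions whose order is reversed by \<open>t\<close>.\<close>
  define F where "F = I t"
  have tt [simp]: "t (t i) = i" for i by (simp add: t_def)
  have ut: "u \<circ> t permutes {1..n}"
    unfolding t_def using u ab by (intro permutes_compose permutes_swap_id)
  have fin: "finite (I u)" "finite (I (u \<circ> t))"
    unfolding I_def using finite_inversions[OF u] finite_inversions[OF ut] by simp_all
  have inj: "u i = u j \<longleftrightarrow> i = j" for i j using permutes_inj[OF u] by (simp add: inj_eq)
  have "bij_betw (\<lambda>(i, j). (t i, t j)) (I (u \<circ> t) - F) (I u - F)"
    by (rule bij_betwI[where g = "\<lambda>(i, j). (t i, t j)"]) 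
       (auto simp: I_def F_def not_less, (metis nat_less_le tt)+)
  then have outside: "card (I (u \<circ> t) - F) = card (I u - F)"
    by (rule bij_betw_same_card)
  have F: "F = insert (a, b) ((\<lambda>c. (a, c)) ` {a<..<b} \<union> (\<lambda>c. (c, b)) ` {a<..<b})"
    unfolding F_def I_def t_def using ab by (auto simp: transpose_def split: if_splits)
  define M where "M P = {c \<in> {a<..<b}. P (u c)}" for P
  have finM [simp]: "finite (M P)" for P by (simp add: M_def)
  have card_un: "card (Pair a ` M P \<union> (\<lambda>c. (c, b)) ` M Q) = card (M P) + card (M Q)" for P Q
    by (subst card_Un_disjoint) (auto simp: M_def card_image inj_on_def)
  have "I u \<inter> F = Pair a ` M (\<lambda>x. x < u a) \<union> (\<lambda>c. (c, b)) ` M (\<lambda>x. u b < x)"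
    unfolding F I_def M_def using ab by auto
  then have cu: "card (I u \<inter> F) = card (M (\<lambda>x. x < u a)) + card (M (\<lambda>x. u b < x))"
    by (simp add: card_un)
  have "I (u \<circ> t) \<inter> F = insert (a, b) (Pair a ` M (\<lambda>x. x < u b) \<union> (\<lambda>c. (c, b)) ` M (\<lambda>x. u a < x))"
    unfolding F I_def M_def t_def using ab by (auto simp: transpose_def)
  moreover have "(a, b) \<notin> Pair a ` M (\<lambda>x. x < u b) \<union> (\<lambda>c. (c, b)) ` M (\<lambda>x. u a < x)"
    by (auto simp: M_def)
  ultimately have cut: "card (I (u \<circ> t) \<inter> F) = card (M (\<lambda>x. x < u b)) + card (M (\<lambda>x. u a < x)) + 1"
    by (simp add: card_un)
  let ?B = "M (\<lambda>x. u a < x \<and> x < u b)"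
  have "M (\<lambda>x. x < u b) = M (\<lambda>x. x < u a) \<union> ?B"
    using ab unfolding M_def by (auto simp: not_less le_less inj)
  then have "card (M (\<lambda>x. x < u b)) = card (M (\<lambda>x. x < u a)) + card ?B"
    by (simp add: card_Un_disjoint M_def disjoint_iff)
  moreover have "M (\<lambda>x. u a < x) = M (\<lambda>x. u b < x) \<union> ?B"
    using ab unfolding M_def by (auto simp: not_less le_less inj)
  then have "card (M (\<lambda>x. u a < x)) = card (M (\<lambda>x. u b < x)) + card ?B"
    by (simp add: card_Un_disjoint M_def disjoint_iff)
  moreover have "len (u \<circ> t) = card (I (u \<circ> t) - F) + card (I (u \<circ> t) \<inter> F)"
    using card_Int_Diff[OF fin(2), of F] by (simp add: len_def I_def)
  moreover have "len u = card (I u - F) + card (I u \<inter> F)"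
    using card_Int_Diff[OF fin(1), of F] by (simp add: len_def I_def)
  moreover have "?B = {c. a < c \<and> c < b \<and> u a < u c \<and> u c < u b}"
    by (auto simp: M_def)
  ultimately show ?thesis
    unfolding t_def[symmetric] using outside cu cut by simp
qed

lemma permutes_w0: "w0 n permutes {1..n}"
  by (rule bij_imp_permutes) (auto simp: w0_def intro!: bij_betwI[where g = "w0 n"])

definition covers_at :: "nat \<Rightarrow> (nat \<Rightarrow> nat) \<Rightarrow> nat \<Rightarrow> bool" where
  "covers_at k u b \<longleftrightarrow> k < b \<and> u k < u b \<and> (\<forall>c. k < c \<and> c < b \<longrightarrow> \<not> (u k < u c \<and> u c < u b))"

lemma len_covers_at_iff:
  assumes u: "u permutes {1..n}" and ab: "a < b" "a \<in> {1..n}" "b \<in> {1..n}"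
  shows "len (u \<circ> transpose a b) = len u + 1 \<longleftrightarrow> covers_at a u b"
proof (cases "u a < u b")
  case True
  have "finite {c. a < c \<and> c < b \<and> u a < u c \<and> u c < u b}"
    by (rule finite_subset[of _ "{a<..<b}"]) auto
  then show ?thesis
    using len_transpose[OF u ab(1) True ab(2,3)] True ab by (auto simp: covers_at_def)
next
  case False
  define v where "v = u \<circ> transpose a b"
  have "u a \<noteq> u b" using permutes_inj[OF u] ab by (metis injD less_irrefl)
  then have "v a < v b" using False by (simp add: v_def)
  moreover have "v permutes {1..n}"
    unfolding v_def using u ab by (intro permutes_compose permutes_swap_id)
  ultimately have "len v < len (v \<circ> transpose a b)"
    using len_transpose[of v n a b] ab by simp
  moreover have "v \<circ> transpose a b = u" by (auto simp: v_def)
  ultimately show ?thesis using False by (auto simp: covers_at_def v_def)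
qed

lemma permutes_transpose_Suc:
  assumes "u permutes {1..n}" and "i \<in> {1..<n}"
  shows "u \<circ> transpose i (Suc i) permutes {1..n}"
  using assms by (intro permutes_compose permutes_swap_id) auto

lemma len_ascent:
  assumes "u permutes {1..n}" and "i \<in> {1..<n}" and "u i < u (Suc i)"
  shows "len (u \<circ> transpose i (Suc i)) = len u + 1"
  using len_covers_at_iff[of u n i "Suc i"] assms by (auto simp: covers_at_def)

lemma len_descent:
  assumes "u permutes {1..n}" and "i \<in> {1..<n}" and "u (Suc i) < u i"
  shows "len u = len (u \<circ> transpose i (Suc i)) + 1"
  using len_ascent[OF permutes_transpose_Suc[OF assms(1,2)] assms(2)] assms(3)
  by (simp add: comp_assoc)

lemma len_id [simp]: "len id = 0"
proof -
  have none: "\<not> (i < j \<and> id j < id i)" for i j :: nat by simp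
  show ?thesis unfolding len_def by (simp only: none) simp
qed

lemma len_inv:
  assumes "bij w"
  shows "len (inv w) = len w"
proof -
  have [simp]: "w (inv w i) = i" "inv w (w i) = i" for i
    using assms by (simp_all add: bij_is_surj bij_is_inj surj_f_inv_f)
  have "bij_betw (\<lambda>(i, j). (w j, w i)) {(i, j). i < j \<and> w j < w i} {(i, j). i < j \<and> inv w j < inv w i}"
    by (rule bij_betwI[where g = "\<lambda>(i, j). (inv w j, inv w i)"]) auto
  then show ?thesis unfolding len_def by (simp add: bij_betw_same_card)
qed

lemma len_le_square:
  assumes "w permutes {1..n}"
  shows "len w \<le> n * n"
  using card_mono[OF _ inversions_subset[OF assms]] by (simp add: len_def card_cartesian_product)

section \<open>Reduced words\<close>

lemma no_descent_imp_id:
  assumes u: "u permutes {1..n::nat}" and asc: "\<And>i. i \<in> {1..<n} \<Longrightarrow> u i < u (Suc i)"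
  shows "u = id"
proof -
  have ge: "i \<le> u i" if "i \<in> {1..n}" for i
    using that
  proof (induction i)
    case (Suc i)
    then show ?case
      using asc[of i] permutes_in_image[OF u, of 1] by (cases "i = 0") fastforce+
  qed simp
  have le: "u i \<le> i" if "i \<in> {1..n}" for i
  proof -
    have "d \<le> n - 1 \<Longrightarrow> u (n - d) \<le> n - d" for d
    proof (induction d)
      case 0
      then show ?case using permutes_in_image[OF u, of n] that by auto
    next
      case (Suc d)
      then have "Suc (n - Suc d) = n - d" "n - Suc d \<in> {1..<n}" by auto
      then show ?case using asc[of "n - Suc d"] Suc by auto
    qed
    from this[of "n - i"] show ?thesis using that by auto
  qed
  show ?thesis
    using ge le permutes_not_in[OF u] by (metis eq_id_iff le_antisym)
qed

lemma word_prod_simps [simp]: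
  "word_prod [] = id" "word_prod (i # is) = transpose i (Suc i) \<circ> word_prod is"
  by (simp_all add: word_prod_def)

lemma permutes_word_prod:
  assumes "set is \<subseteq> {1..<n}"
  shows "word_prod is permutes {1..n}"
  using assms
proof (induction "is")
  case (Cons i "is")
  then show ?case
    unfolding word_prod_simps by (intro permutes_compose permutes_swap_id) auto
qed (simp only: word_prod_simps permutes_id)

lemma ex_reduced_word:
  assumes "v permutes {1..n}"
  shows "\<exists>is. reduced_word n is v"
  using assms
proof (induction "len v" arbitrary: v rule: less_induct)
  case less
  note v = less.prems
  show ?case
  proof (cases "\<exists>i \<in> {1..<n}. inv v (Suc i) < inv v i")
    case True
    then obtain i where i: "i \<in> {1..<n}" "inv v (Suc i) < inv v i" by blast
    let ?s = "transpose i (Suc i)"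
    have inv_sv: "inv (?s \<circ> v) = inv v \<circ> ?s"
      using v by (simp add: o_inv_distrib permutes_bij)
    have sv: "?s \<circ> v permutes {1..n}"
      using v i by (intro permutes_compose permutes_swap_id) auto
    have "len (inv v) = len (inv v \<circ> ?s) + 1"
      using len_descent[OF permutes_inv[OF v] i] .
    then have l: "len v = len (?s \<circ> v) + 1"
      using len_inv[OF permutes_bij[OF v]] len_inv[OF permutes_bij[OF sv]] by (simp add: inv_sv)
    then obtain "is" where "is": "reduced_word n is (?s \<circ> v)"
      using less.hyps[of "?s \<circ> v"] sv by auto
    have "?s \<circ> (?s \<circ> v) = v" by (simp flip: comp_assoc)
    then have "reduced_word n (i # is) v"
      using "is" l i by (simp add: reduced_word_def)
    then show ?thesis ..
  next
    case False
    have "inv v i \<noteq> inv v (Suc i)" for i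
      using permutes_inj[OF permutes_inv[OF v]] by (metis injD n_not_Suc_n)
    then have "inv v = id"
      using False by (intro no_descent_imp_id[OF permutes_inv[OF v]]) (metis linorder_less_linear)
    then have "v = id"
      by (metis inv_id inv_inv_eq permutes_bij v)
    then have "reduced_word n [] v" by (simp add: reduced_word_def)
    then show ?thesis ..
  qed
qed

text \<open>
  A letter changes the length by one, so a word that attains its length as a product does so at each
  of its suffixes; the first letter must then lengthen the rest.
\<close>

lemma reduced_word_Cons:
  assumes "set (i # is) \<subseteq> {1..<n}" and "length (i # is) = len (word_prod (i # is))"
  shows "length is = len (word_prod is)" and "inv (word_prod is) i < inv (word_prod is) (Suc i)"
proof -
  have len_le: "len (transpose i (Suc i) \<circ> v) = len v + 1 \<and> inv v i < inv v (Suc i) \<or>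
      len v = len (transpose i (Suc i) \<circ> v) + 1" if v: "v permutes {1..n}" and i: "i \<in> {1..<n}" for v i
  proof -
    let ?s = "transpose i (Suc i)"
    have sv: "?s \<circ> v permutes {1..n}"
      using v i by (intro permutes_compose permutes_swap_id) auto
    have l: "len (?s \<circ> v) = len (inv v \<circ> ?s)" "len v = len (inv v)"
      using len_inv[OF permutes_bij[OF sv]] len_inv[OF permutes_bij[OF v]] v
      by (simp_all add: o_inv_distrib permutes_bij)
    have "inv v i \<noteq> inv v (Suc i)"
      using permutes_inj[OF permutes_inv[OF v]] by (metis injD n_not_Suc_n)
    then show ?thesis
      unfolding l using len_ascent[OF permutes_inv[OF v] i] len_descent[OF permutes_inv[OF v] i]
      by linarith
  qed
  have bound: "len (word_prod js) \<le> length js" if "set js \<subseteq> {1..<n}" for js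
    using that
  proof (induction js)
    case (Cons j js)
    then have "len (transpose j (Suc j) \<circ> word_prod js) \<le> len (word_prod js) + 1"
      using len_le[OF permutes_word_prod[of js n], of j] Cons.prems by fastforce
    moreover have "len (word_prod js) \<le> length js" using Cons by simp
    ultimately show ?case unfolding word_prod_simps list.size(4) by linarith
  qed simp
  have "is": "set is \<subseteq> {1..<n}" and i: "i \<in> {1..<n}" using assms(1) by simp_all
  have "len (transpose i (Suc i) \<circ> word_prod is) = Suc (length is)"
    using assms(2) unfolding word_prod_simps list.size(4) by linarith
  then show "length is = len (word_prod is)" "inv (word_prod is) i < inv (word_prod is) (Suc i)"
    using len_le[OF permutes_word_prod[OF "is"] i] bound[OF "is"] by linarith+
qed

section \<open>Sums over chains with decreasing labels\<close>

text \<open>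
  \<open>descending_sum k F p u\<close> is the sum of \<open>F\<close> over the ends of all chains, possibly empty, that start
  at \<open>u\<close> and consist of covers with labels \<open>(k, b\<^sub>1), (k, b\<^sub>2), \<dots>\<close> where \<open>p > b\<^sub>1 > b\<^sub>2 > \<dots>\<close>. The
  recursion on \<open>p\<close> decides whether the first label is the largest one allowed, and displays the sum
  as a product of operators, one for each possible label.
\<close>

primrec descending_sum :: "nat \<Rightarrow> ((nat \<Rightarrow> nat) \<Rightarrow> 'a) \<Rightarrow> nat \<Rightarrow> (nat \<Rightarrow> nat) \<Rightarrow> 'a::ab_group_add" where
  "descending_sum k F 0 u = F u"
| "descending_sum k F (Suc p) u =
    descending_sum k F p u + (if covers_at k u p then descending_sum k F p (u \<circ> transpose k p) else 0)"

lemma descending_sum_le: "p \<le> Suc k \<Longrightarrow> descending_sum k F p u = F u"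
  by (induction p) (auto simp: covers_at_def)

lemma descending_sum_additive:
  assumes "\<And>x y. h (x + y) = h x + h y" "h 0 = 0"
  shows "h (descending_sum k F p u) = descending_sum k (\<lambda>z. h (F z)) p u"
  by (induction p arbitrary: u) (simp_all add: assms)

text \<open>
  Only the empty chain contributes the value of \<open>F\<close> at the starting point itself; all other chains
  end in longer permutations with the same values at the positions before \<open>k\<close>. Thus a value of \<open>F\<close>
  that is still unknown can be separated from the rest of the sum.
\<close>

lemma descending_sum_cong_longer:
  assumes "\<And>z. z permutes {1..n} \<Longrightarrow> len u < len z \<Longrightarrow> (\<And>c. c < k \<Longrightarrow> z c = u c) \<Longrightarrow> F z = G z"
    and "u permutes {1..n}" "1 \<le> k" "p \<le> Suc n"
  shows "descending_sum k F p u - F u = descending_sum k G p u - G u"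
  using assms
proof (induction p arbitrary: u)
  case (Suc p)
  let ?v = "u \<circ> transpose k p"
  have "descending_sum k F p ?v = descending_sum k G p ?v" if c: "covers_at k u p"
  proof -
    have kp: "k < p" "k \<in> {1..n}" "p \<in> {1..n}" using c Suc.prems by (auto simp: covers_at_def)
    have v: "?v permutes {1..n}"
      using Suc.prems kp by (intro permutes_compose permutes_swap_id)
    have same: "?v c = u c" if "c < k" for c using that kp by (simp add: transpose_def)
    have "len ?v = len u + 1" using len_covers_at_iff[OF Suc.prems(2) kp] c by simp
    then have FG: "F z = G z" if "z permutes {1..n}" "len ?v \<le> len z" "\<And>c. c < k \<Longrightarrow> z c = ?v c" for z
      using Suc.prems(1)[of z] that same by (simp del: o_apply)
    have "descending_sum k F p ?v - F ?v = descending_sum k G p ?v - G ?v"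
      by (rule Suc.IH) (use FG v Suc.prems in \<open>simp_all del: o_apply\<close>)
    then show ?thesis using FG[OF v] by (simp del: o_apply)
  qed
  moreover have "descending_sum k F p u - F u = descending_sum k G p u - G u"
    by (rule Suc.IH) (use Suc.prems in simp_all)
  ultimately show ?case by (simp add: algebra_simps)
qed simp

text \<open>
  The action of the generator \<open>i\<close> of the 0-Hecke algebra, dual to right multiplication. It prescribes
  how \<open>\<mu>\<^sub>i\<close> ought to act on the values of a function of permutations.
\<close>

definition hecke :: "nat \<Rightarrow> ((nat \<Rightarrow> nat) \<Rightarrow> 'a) \<Rightarrow> (nat \<Rightarrow> nat) \<Rightarrow> 'a::ab_group_add" where
  "hecke i F u = (if u (Suc i) < u i then F (u \<circ> transpose i (Suc i)) else - F u)"

lemma hecke_descent: "u (Suc i) < u i \<Longrightarrow> hecke i F u = F (u \<circ> transpose i (Suc i))"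
  and hecke_ascent: "u i < u (Suc i) \<Longrightarrow> hecke i F u = - F u"
  by (simp_all add: hecke_def)

lemma covers_at_transpose_Suc:
  assumes "k < i" "p \<noteq> i" "p \<noteq> Suc i"
  shows "covers_at k (u \<circ> transpose i (Suc i)) p \<longleftrightarrow> covers_at k u p"
proof -
  have "(\<forall>c. k < c \<and> c < p \<longrightarrow> P (transpose i (Suc i) c)) \<longleftrightarrow> (\<forall>c. k < c \<and> c < p \<longrightarrow> P c)" for P
  proof -
    have "k < transpose i (Suc i) c \<and> transpose i (Suc i) c < p \<longleftrightarrow> k < c \<and> c < p" for c
      using assms by (auto simp: transpose_def)
    then show ?thesis by (metis transpose_involutory)
  qed
  from this[of "\<lambda>c. \<not> (u k < u c \<and> u c < u p)"] show ?thesis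
    using assms by (auto simp: covers_at_def)
qed

lemma transpose_commute_Suc:
  assumes "k < i" "p \<noteq> i" "p \<noteq> Suc i"
  shows "u \<circ> transpose i (Suc i) \<circ> transpose k p = u \<circ> transpose k p \<circ> transpose i (Suc i)"
  using assms by (auto simp: fun_eq_iff transpose_def)

lemma hecke_descending_sum_Suc:
  assumes "k < i" "p \<noteq> i" "p \<noteq> Suc i"
  shows "hecke i (descending_sum k F (Suc p)) u = hecke i (descending_sum k F p) u +
    (if covers_at k u p then hecke i (descending_sum k F p) (u \<circ> transpose k p) else 0)"
proof -
  have "(u \<circ> transpose k p) i = u i" "(u \<circ> transpose k p) (Suc i) = u (Suc i)"
    using assms by (auto simp: transpose_def)
  then show ?thesis
    unfolding hecke_def descending_sum.simps covers_at_transpose_Suc[OF assms] transpose_commute_Suc[OF assms]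
    by simp
qed

lemma descending_sum_hecke_below:
  assumes "k < i" "p \<le> i"
  shows "descending_sum k (hecke i F) p u = hecke i (descending_sum k F p) u"
  using assms
proof (induction p arbitrary: u)
  case (Suc p)
  then have p: "p \<noteq> i" "p \<noteq> Suc i" "p \<le> i" by auto
  show ?case
    unfolding hecke_descending_sum_Suc[OF \<open>k < i\<close> p(1,2)] by (simp add: Suc.IH[OF \<open>k < i\<close> p(3)] del: o_apply)
qed (simp add: hecke_def)

text \<open>
  The heart of the combinatorics: labels \<open>i\<close> and \<open>i + 1\<close> are the only ones affected by the action at
  the positions \<open>i\<close> and \<open>i + 1\<close>. Let \<open>a\<close>, \<open>q < r\<close> be the values of \<open>u\<close> at \<open>k\<close>, \<open>i\<close>, \<open>i + 1\<close>, and
  call a value admissible if no position strictly between \<open>k\<close> and \<open>i\<close> prevents \<open>a\<close> from moving up to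
  it. From \<open>u\<close> one can use at most one of the two labels. From \<open>u s\<^sub>i\<close> one can use both only if \<open>q\<close>
  and \<open>r\<close> are both admissible; the chain of two covers then leads to the value \<open>r\<close> at \<open>k\<close>, as does the
  single cover by \<open>r\<close>, with \<open>a\<close> and \<open>q\<close> exchanged, and these two contributions cancel under the action.
\<close>

lemma descending_sum_hecke_ascent:
  fixes u :: "nat \<Rightarrow> nat"
  assumes "inj u" "k < i" and asc: "u i < u (Suc i)"
  shows "descending_sum k (hecke i F) (Suc (Suc i)) u = - descending_sum k F (Suc (Suc i)) u"
    and "descending_sum k (hecke i F) (Suc (Suc i)) (u \<circ> transpose i (Suc i)) = descending_sum k F (Suc (Suc i)) u"
proof -
  let ?s = "transpose i (Suc i)" and ?t = "transpose k i" and ?t' = "transpose k (Suc i)"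
  define v where "v = u \<circ> ?s"
  define G where "G = descending_sum k F i"
  define a q r where "a = u k" and "q = u i" and "r = u (Suc i)"
  have distinct: "u x = u y \<longleftrightarrow> x = y" for x y using \<open>inj u\<close> by (simp add: inj_eq)
  have ne: "a \<noteq> q" "a \<noteq> r" "q < r" using \<open>k < i\<close> asc by (simp_all add: a_def q_def r_def distinct)
  define ok where "ok x y \<longleftrightarrow> x < y \<and> (\<forall>c. k < c \<and> c < i \<longrightarrow> \<not> (x < u c \<and> u c < y))" for x y
  have H: "descending_sum k (hecke i F) i z = hecke i G z" for z
    unfolding G_def using \<open>k < i\<close> by (intro descending_sum_hecke_below) auto
  \<comment> \<open>Only the last two labels are unfolded; \<open>G\<close> collects the chains with labels below \<open>i\<close>.\<close>
  have two: "descending_sum k F' (Suc (Suc i)) z =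
      descending_sum k F' i z + (if covers_at k z i then descending_sum k F' i (z \<circ> ?t) else 0) +
      (if covers_at k z (Suc i) then descending_sum k F' i (z \<circ> ?t') +
         (if covers_at k (z \<circ> ?t') i then descending_sum k F' i (z \<circ> ?t' \<circ> ?t) else 0) else 0)"
    for F' :: "(nat \<Rightarrow> nat) \<Rightarrow> 'a" and z
    by simp
  have less_Suc: "(\<forall>c. k < c \<and> c < Suc i \<longrightarrow> P c) \<longleftrightarrow> P i \<and> (\<forall>c. k < c \<and> c < i \<longrightarrow> P c)" for P
    using \<open>k < i\<close> by (auto simp: less_Suc_eq)
  have ui: "covers_at k u i \<longleftrightarrow> ok a q"
    using \<open>k < i\<close> by (simp add: covers_at_def ok_def a_def q_def)
  have ui': "covers_at k u (Suc i) \<longleftrightarrow> ok a r \<and> \<not> a < q"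
    using \<open>k < i\<close> ne unfolding covers_at_def less_Suc by (auto simp: ok_def a_def q_def r_def)
  have uti: "\<not> covers_at k (u \<circ> ?t') i"
    using \<open>k < i\<close> ne by (auto simp: covers_at_def a_def q_def r_def transpose_def)
  have vi: "covers_at k v i \<longleftrightarrow> ok a r"
    using \<open>k < i\<close> by (auto simp: covers_at_def ok_def a_def r_def v_def transpose_def)
  have vi': "covers_at k v (Suc i) \<longleftrightarrow> ok a q"
    using \<open>k < i\<close> ne unfolding covers_at_def less_Suc
    by (auto simp: ok_def a_def q_def r_def v_def transpose_def)
  have vti: "covers_at k (v \<circ> ?t') i \<longleftrightarrow> ok q r"
    using \<open>k < i\<close> by (auto simp: covers_at_def ok_def q_def r_def v_def transpose_def)
  have perms: "v \<circ> ?s = u" "v \<circ> ?t \<circ> ?s = u \<circ> ?t'" "v \<circ> ?t' \<circ> ?s = u \<circ> ?t"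
      "v \<circ> ?t' \<circ> ?t \<circ> ?s = v \<circ> ?t"
    using \<open>k < i\<close> by (auto simp: v_def fun_eq_iff transpose_def)
  have Hu: "hecke i G u = - G u" using ne by (simp add: hecke_def q_def r_def)
  have Hut: "hecke i G (u \<circ> ?t) = - G (u \<circ> ?t)" if "a < q"
    using that ne \<open>k < i\<close> by (simp add: hecke_def a_def q_def r_def transpose_def)
  have Hut': "hecke i G (u \<circ> ?t') = - G (u \<circ> ?t')" if "\<not> a < q"
    using that ne \<open>k < i\<close> by (simp add: hecke_def a_def q_def r_def transpose_def)
  have Hv: "hecke i G v = G u"
    using ne perms by (simp add: hecke_def q_def r_def v_def)
  have Hvt1: "hecke i G (v \<circ> ?t) = - G (v \<circ> ?t)" if "a < q"
    using that ne \<open>k < i\<close> by (simp add: hecke_def a_def q_def r_def transpose_def v_def)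
  have Hvt2: "hecke i G (v \<circ> ?t) = G (u \<circ> ?t')" if "\<not> a < q"
    using that ne \<open>k < i\<close> unfolding hecke_def perms
    by (simp add: a_def q_def r_def transpose_def v_def)
  have Hvt': "hecke i G (v \<circ> ?t') = G (u \<circ> ?t)" if "a < q"
    using that ne \<open>k < i\<close> unfolding hecke_def perms
    by (simp add: a_def q_def r_def transpose_def v_def)
  have Hvtt: "hecke i G (v \<circ> ?t' \<circ> ?t) = G (v \<circ> ?t)" if "a < q"
    using that ne \<open>k < i\<close> unfolding hecke_def perms
    by (simp add: a_def q_def r_def transpose_def v_def)
  have okq: "a < q" if "ok a q" using that by (simp add: ok_def)
  have okr: "ok a q" if "ok a r" "a < q" using that ne unfolding ok_def by force
  \<comment> \<open>No value lies strictly between \<open>a\<close> and \<open>r\<close> iff none lies in either of the two parts cut by \<open>q\<close>.\<close>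
  have okqr: "ok q r \<longleftrightarrow> ok a r" if "ok a q"
  proof
    assume "ok q r"
    have "\<not> (a < u c \<and> u c < r)" if c: "k < c" "c < i" for c
    proof -
      have "u c \<noteq> q" using c by (simp add: q_def distinct)
      then show ?thesis using \<open>ok a q\<close> \<open>ok q r\<close> c unfolding ok_def by (meson linorder_neqE_nat)
    qed
    then show "ok a r" using \<open>ok a q\<close> ne by (auto simp: ok_def)
  next
    assume "ok a r"
    then show "ok q r" using \<open>ok a q\<close> ne by (auto simp: ok_def)
  qed
  note F2 = two[of F u, folded G_def, unfolded ui ui']
  show "descending_sum k (hecke i F) (Suc (Suc i)) u = - descending_sum k F (Suc (Suc i)) u"
    unfolding F2 two[of "hecke i F"] H ui ui' using uti okq Hu Hut Hut' by auto
  show "descending_sum k (hecke i F) (Suc (Suc i)) (u \<circ> ?s) = descending_sum k F (Suc (Suc i)) u"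
    unfolding v_def[symmetric] F2 two[of "hecke i F"] H vi vi' vti
    using uti okq okr okqr Hv Hvt1 Hvt2 Hvt' Hvtt by (auto simp del: o_apply)
qed

text \<open>
  Labels above \<open>i + 1\<close> do not see the order of the values at \<open>i\<close> and \<open>i + 1\<close>, so the commutation
  at \<open>p = i + 2\<close> extends to all larger bounds.
\<close>

lemma descending_sum_hecke:
  fixes u :: "nat \<Rightarrow> nat"
  assumes "inj u" "k < i" "Suc i < p"
  shows "descending_sum k (hecke i F) p u = hecke i (descending_sum k F p) u"
proof -
  from \<open>Suc i < p\<close> have "Suc (Suc i) \<le> p" by simp
  then show ?thesis using \<open>inj u\<close>
  proof (induction p arbitrary: u rule: dec_induct)
    case (base u)
    show ?case
    proof (cases "u (Suc i) < u i")
      case True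
      let ?v = "u \<circ> transpose i (Suc i)"
      have "?v \<circ> transpose i (Suc i) = u" by (simp add: comp_assoc)
      moreover have "inj ?v" using base by (simp add: inj_compose)
      moreover have "?v i < ?v (Suc i)" using True by simp
      ultimately show ?thesis
        using descending_sum_hecke_ascent(2)[of ?v k i F] \<open>k < i\<close> True by (simp only: hecke_descent)
    next
      case False
      moreover have "u i \<noteq> u (Suc i)" using base by (metis injD n_not_Suc_n)
      ultimately show ?thesis
        using descending_sum_hecke_ascent(1)[of u k i F] base \<open>k < i\<close>
        by (metis hecke_ascent linorder_neqE_nat)
    qed
  next
    case (step p u)
    then have p: "p \<noteq> i" "p \<noteq> Suc i" by auto
    have "inj (u \<circ> transpose k p)" using step.prems by (simp add: inj_compose)
    then show ?case
      unfolding hecke_descending_sum_Suc[OF \<open>k < i\<close> p] using step.IH step.prems by (simp del: o_apply)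
  qed
qed

text \<open>
  Suppose that \<open>w (k + 1)\<close> exceeds \<open>w k\<close> and all later values in question. The value at \<open>k + 1\<close> then
  never blocks a cover of label \<open>(k, b)\<close> with \<open>b > k + 1\<close>, and these covers correspond to the covers
  of label \<open>(k + 1, b)\<close> from \<open>w s\<^sub>k\<close>. The remaining label \<open>(k, k + 1)\<close>, the smallest one, is always
  available as a last step; it accounts for the two summands.
\<close>

lemma descending_sum_shift:
  fixes w :: "nat \<Rightarrow> nat"
  assumes "Suc (Suc k) \<le> p" and "w k < w (Suc k)" and "\<And>c. Suc k < c \<Longrightarrow> c < p \<Longrightarrow> w c < w (Suc k)"
  shows "descending_sum k F p w =
    descending_sum (Suc k) (\<lambda>z. F z + F (z \<circ> transpose k (Suc k))) p (w \<circ> transpose k (Suc k))"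
  using assms
proof (induction p arbitrary: w rule: dec_induct)
  case (base w)
  let ?s = "transpose k (Suc k)"
  have "w \<circ> ?s \<circ> ?s = w" by (simp add: comp_assoc)
  moreover have "covers_at k w (Suc k)" using base by (auto simp: covers_at_def)
  ultimately show ?case by (simp add: descending_sum_le covers_at_def del: o_apply)
next
  case (step p w)
  let ?s = "transpose k (Suc k)" and ?t = "transpose k p" and ?t' = "transpose (Suc k) p"
  have less: "(\<forall>c. k < c \<and> c < p \<longrightarrow> P c) \<longleftrightarrow> P (Suc k) \<and> (\<forall>c. Suc k < c \<and> c < p \<longrightarrow> P c)" for P
    using step.hyps by (metis Suc_le_eq Suc_lessI lessI less_trans)
  have at: "?s p = p" "\<And>c. Suc k < c \<Longrightarrow> ?s c = c" using step.hyps by (simp_all add: transpose_def)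
  have wp: "w p < w (Suc k)" using step by simp
  have cov: "covers_at (Suc k) (w \<circ> ?s) p \<longleftrightarrow> covers_at k w p"
    using step.hyps wp unfolding covers_at_def less by (auto simp: at)
  have comm: "w \<circ> ?s \<circ> ?t' = w \<circ> ?t \<circ> ?s"
    using step.hyps by (auto simp: fun_eq_iff transpose_def)
  have tw: "(w \<circ> ?t) k = w p" "(w \<circ> ?t) (Suc k) = w (Suc k)" 
     "\<And>c. Suc k < c \<Longrightarrow> c < p \<Longrightarrow> (w \<circ> ?t) c = w c"
    using step.hyps by (auto simp: transpose_def)
  have IH: "descending_sum k F p w = descending_sum (Suc k) (\<lambda>z. F z + F (z \<circ> ?s)) p (w \<circ> ?s)"
    using step.prems by (intro step.IH) auto
  moreover have "descending_sum k F p (w \<circ> ?t) = descending_sum (Suc k) (\<lambda>z. F z + F (z \<circ> ?s)) p (w \<circ> ?t \<circ> ?s)"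
    by (rule step.IH) (use step.prems wp in \<open>simp_all add: tw del: o_apply\<close>)
  ultimately show ?case
    by (simp add: cov comm del: o_apply)
qed

section \<open>The Monk recursion determines the operators\<close>

declare descending_sum.simps(2) [simp del]

lemma weight_ne_0: "vx i + vy j - vx i * vy j \<noteq> 0"
proof
  assume "vx i + vy j - vx i * vy j = 0"
  then have "Poly_Mapping.lookup (vx i + vy j - vx i * vy j) (Poly_Mapping.single (X i) 1) = 0"
    by simp
  moreover have "Poly_Mapping.single (Y j) (Suc 0) \<noteq> Poly_Mapping.single (X i) (Suc 0)"
    using indet_eq_iff[of "Y j" "X i"] by (auto simp: indet_def)
  moreover have "Poly_Mapping.single (X i) (Suc 0) + Poly_Mapping.single (Y j) (Suc 0) \<noteq> Poly_Mapping.single (X i) (Suc 0)"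
  proof
    assume "Poly_Mapping.single (X i) (Suc 0) + Poly_Mapping.single (Y j) (Suc 0) = Poly_Mapping.single (X i) (Suc 0)"
    then have "Poly_Mapping.single (Y j) (Suc 0) = 0" by simp
    then have "Poly_Mapping.keys (Poly_Mapping.single (Y j) (Suc 0)) = {}" by simp
    then show False by simp
  qed
  ultimately show False
    by (simp add: indet_def mult_single lookup_minus lookup_add lookup_single when_def)
qed

lemma ratfun_weight: "ratfun (vx i + vy j - vx i * vy j) = 1 - cx i * cy j"
  by (simp add: cx_def cy_def algebra_simps)

lemma cx_cy_ne_1: "cx i * cy j \<noteq> 1"
  using weight_ne_0[of i j] unfolding ratfun_eq_iff[symmetric] ratfun_weight by simp

text \<open>
  All factors of the top polynomial except \<open>1 - cx k * cy (n - k)\<close> are permuted by \<open>s\<^sub>k\<close>. The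
  value of \<open>\<mu>\<^sub>k\<close> is put into the form that the recursion yields for permutations other than \<open>\<omega>\<^sub>0\<close>.
\<close>

lemma mu_rat_H_top:
  assumes k: "k \<in> {1..<n}"
  shows "mu_rat k (ratfun (H_top n)) =
    cx k * cy (n - k) * (ratfun (H_top n) + mu_rat k (ratfun (H_top n)))"
proof -
  let ?s = "transpose k (Suc k)"
  define A where "A = {(i, j). 1 \<le> i \<and> 1 \<le> j \<and> i + j \<le> n} - {(k, n - k)}"
  define g where "g = (\<Prod>(i, j)\<in>A. 1 - cx i * cy j)"
  have "finite {(i, j). 1 \<le> i \<and> 1 \<le> j \<and> i + j \<le> n}"
    by (rule finite_subset[of _ "{..n} \<times> {..n}"]) auto
  then have fin: "finite A" by (simp add: A_def)
  have split: "{(i, j). 1 \<le> i \<and> 1 \<le> j \<and> i + j \<le> n} = insert (k, n - k) A"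
    using k by (auto simp: A_def)
  have "ratfun (H_top n) = (\<Prod>(i, j) | 1 \<le> i \<and> 1 \<le> j \<and> i + j \<le> n. 1 - cx i * cy j)"
    unfolding H_top_def ratfun_prod by (intro prod.cong refl) (simp add: case_prod_beta ratfun_weight del: ratfun_hom)
  also have "\<dots> = (1 - cx k * cy (n - k)) * g"
    unfolding split g_def using fin by (subst prod.insert) (auto simp: A_def)
  finally have top: "ratfun (H_top n) = (1 - cx k * cy (n - k)) * g" .
  have swap_prod: "swap_rat k (\<Prod>a\<in>B. f a) = (\<Prod>a\<in>B. swap_rat k (f a))" for f and B :: "(nat \<times> nat) set"
    by (induction B rule: infinite_finite_induct) (simp_all add: swap_rat_mult)
  have "swap_rat k g = (\<Prod>(i, j)\<in>A. 1 - cx (?s i) * cy j)"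
    unfolding g_def swap_prod by (intro prod.cong refl) (auto simp: swap_rat_hom swap_rat_cx)
  also have "\<dots> = g"
    unfolding g_def
    by (rule prod.reindex_bij_witness[where i = "\<lambda>(i, j). (?s i, j)" and j = "\<lambda>(i, j). (?s i, j)"])
      (use k in \<open>auto simp: A_def transpose_def split: if_splits\<close>)
  finally have g: "swap_rat k g = g" .
  have "mu_rat k (ratfun (H_top n)) = cx k * cy (n - k) * g"
  proof -
    have "cx (Suc k) - cx k \<noteq> 0" by simp
    then show ?thesis
      unfolding top by (simp add: mu_rat_def swap_rat_hom swap_rat_cx g divide_simps) (simp add: algebra_simps)
  qed
  then show ?thesis unfolding top by (simp add: algebra_simps)
qed

text \<open>
  Before a climbing chain touches position \<open>k\<close>, the earlier positions carry the values
  \<open>n, n - 1, \<dots>\<close>, as they do in \<open>\<omega>\<^sub>0\<close>.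
\<close>

definition maximal_below :: "nat \<Rightarrow> nat \<Rightarrow> (nat \<Rightarrow> nat) \<Rightarrow> bool" where
  "maximal_below n k w \<longleftrightarrow> (\<forall>j\<in>{1..<k}. w j = n + 1 - j)"

lemma maximal_belowD: "maximal_below n k w \<Longrightarrow> 1 \<le> j \<Longrightarrow> j < k \<Longrightarrow> w j = n + 1 - j"
  by (simp add: maximal_below_def)

lemma maximal_below_le:
  assumes w: "w permutes {1..n}" and "maximal_below n k w" "1 \<le> k" "k \<le> j" "j \<le> n"
  shows "w j \<le> n + 1 - k"
proof (rule ccontr)
  assume "\<not> w j \<le> n + 1 - k"
  moreover have "w j \<in> {1..n}" using permutes_in_image[OF w] assms by simp
  ultimately have c: "1 \<le> n + 1 - w j" "n + 1 - w j < k" "n + 1 - (n + 1 - w j) = w j" using assms by auto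
  then have "w (n + 1 - w j) = w j" using maximal_belowD[OF assms(2)] by metis
  then have "n + 1 - w j = j" using permutes_inj[OF w] by (metis injD)
  then show False using c assms by simp
qed

lemma maximal_below_less:
  assumes "w permutes {1..n}" "maximal_below n k w" "1 \<le> k" "k < j" "j \<le> n" "w k = n + 1 - k"
  shows "w j < w k"
proof -
  have "w j \<noteq> w k" using permutes_inj[OF assms(1)] assms(4) by (metis injD less_irrefl)
  then show ?thesis using maximal_below_le[OF assms(1-3), of j] assms by simp
qed

lemma maximal_below_ascent:
  assumes w: "w permutes {1..n}" and t: "maximal_below n k w" "1 \<le> k" and i: "i \<in> {1..<n}" "w i < w (Suc i)"
  shows "k \<le> i"
proof (rule ccontr)
  assume "\<not> k \<le> i"
  then have "maximal_below n i w" "w i = n + 1 - i" using t i by (auto simp: maximal_below_def)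
  then show False using maximal_below_less[OF w, of i "Suc i"] i by simp
qed

lemma ex_first_nonmaximal:
  assumes w: "w permutes {1..n}" and "w \<noteq> w0 n"
  obtains k where "k \<in> {1..n}" "maximal_below n k w" "w k \<noteq> n + 1 - k"
proof -
  define P where "P k \<longleftrightarrow> k \<in> {1..n} \<and> w k \<noteq> n + 1 - k" for k
  have "\<exists>k. P k"
  proof (rule ccontr)
    assume "\<nexists>k. P k"
    then have "w = w0 n"
      using permutes_not_in[OF w] by (auto simp: fun_eq_iff P_def w0_def)
    then show False using assms by simp
  qed
  then have "P (LEAST k. P k)" by (rule LeastI_ex)
  moreover have "maximal_below n (LEAST k. P k) w"
    unfolding maximal_below_def
  proof
    fix j assume j: "j \<in> {1..<LEAST k. P k}"
    then have "\<not> P j" using not_less_Least by auto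
    moreover have "j \<in> {1..n}" using j \<open>P (LEAST k. P k)\<close> by (auto simp: P_def)
    ultimately show "w j = n + 1 - j" by (simp add: P_def)
  qed
  ultimately show ?thesis using that[of "LEAST k. P k"] unfolding P_def by blast
qed

lemma maximal_below_max:
  assumes w: "w permutes {1..n}" and t: "maximal_below n k w" "k \<in> {1..n}"
    and dec: "\<And>c. k < c \<Longrightarrow> c \<le> n \<Longrightarrow> w c < w k"
  shows "w k = n + 1 - k"
proof -
  have "n + 1 - k \<in> w ` {1..n}" using permutes_image[OF w] t by auto
  then obtain j where j: "j \<in> {1..n}" "w j = n + 1 - k" by force
  have "k \<le> j"
  proof (rule ccontr)
    assume "\<not> k \<le> j"
    then have "w j = n + 1 - j" using maximal_belowD[OF t(1), of j] j by simp
    then show False using j \<open>\<not> k \<le> j\<close> t by simp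
  qed
  then have "n + 1 - k \<le> w k" using dec[of j] j by (cases "j = k") auto
  then show ?thesis using maximal_below_le[OF w t(1), of k] t by simp
qed

lemma descending_sum_no_cover: "(\<And>q. q < p \<Longrightarrow> \<not> covers_at k u q) \<Longrightarrow> descending_sum k F p u = F u"
  by (induction p) (simp_all add: descending_sum.simps(2))

lemma decreasing_from:
  fixes w :: "nat \<Rightarrow> nat"
  assumes "\<And>j. k < j \<Longrightarrow> j < n \<Longrightarrow> w (Suc j) < w j" and "k < a" "a < b" "b \<le> n"
  shows "w b < w a"
proof -
  from \<open>a < b\<close> have "Suc a \<le> b" by simp
  then show ?thesis using \<open>b \<le> n\<close>
  proof (induction b rule: dec_induct)
    case base
    then show ?case using assms by simp
  next
    case (step b)
    then have "w (Suc b) < w b" using assms(1)[of b] \<open>k < a\<close> by simp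
    then show ?case using step by simp
  qed
qed

text \<open>
  The recursion at \<open>w\<close> has the form \<open>c = q (c + R)\<close>, where \<open>q \<noteq> 1\<close> and \<open>R\<close> involves only longer
  permutations. So it suffices to show that \<open>g = \<mu>\<^sub>i (C (w s\<^sub>i))\<close> satisfies the same equation, that
  is, the recursion for the function \<open>C(w := g)\<close>; this is the local fact \<open>finish\<close>. The ascents greater
  than \<open>k\<close> are treated by \<open>later\<close>. At the ascent \<open>k\<close>, a further ascent reduces the claim to a braid
  or commutation relation; otherwise \<open>w\<close> decreases after position \<open>k\<close>.
\<close>

lemma mu_rat_of_monk_recursion:
  fixes C :: "(nat \<Rightarrow> nat) \<Rightarrow> xypoly fract"
  assumes top: "C (w0 n) = ratfun (H_top n)"
    and rec: "\<And>w k. w permutes {1..n} \<Longrightarrow> k \<in> {1..n} \<Longrightarrow> maximal_below n k w \<Longrightarrow> w k \<noteq> n + 1 - k \<Longrightarrow>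
      C w = cx k * cy (w k) * descending_sum k C (Suc n) w"
    and w: "w permutes {1..n}" and i: "i \<in> {1..<n}" and asc: "w i < w (Suc i)"
  shows "C w = mu_rat i (C (w \<circ> transpose i (Suc i)))"
  using w i asc
proof (induction "n * n - len w" arbitrary: w i rule: less_induct)
  case less
  note w = less.prems(1) and i = less.prems(2) and asc = less.prems(3)
  have IH: "C z = mu_rat j (C (z \<circ> transpose j (Suc j)))"
    if "z permutes {1..n}" "len w < len z" "j \<in> {1..<n}" "z j < z (Suc j)" for z j
    using less.hyps[of z j] that len_le_square[of z n] by simp
  have IH_descent: "mu_rat j (C z) = C (z \<circ> transpose j (Suc j))"
    if z: "z permutes {1..n}" "len w + 1 < len z" "j \<in> {1..<n}" "z (Suc j) < z j" for z j
  proof -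
    have "z \<circ> transpose j (Suc j) \<circ> transpose j (Suc j) = z" by (simp add: comp_assoc)
    then show ?thesis
      using IH[OF permutes_transpose_Suc[OF z(1,3)] _ z(3)] len_descent[OF z(1,3,4)] z by simp
  qed
  have "w \<noteq> w0 n" using i asc by (auto simp: w0_def)
  then obtain k where k: "k \<in> {1..n}" "maximal_below n k w" "w k \<noteq> n + 1 - k"
    using ex_first_nonmaximal[OF w] by blast
  have "k \<le> i" using maximal_below_ascent[OF w k(2) _ i asc] k by simp
  \<comment> \<open>\<open>C\<close> and \<open>C(w := g)\<close> agree on all longer permutations.\<close>
  have finish: "C w = g" if g: "g = cx k * cy (w k) * descending_sum k (C(w := g)) (Suc n) w" for g
  proof -
    have "descending_sum k (C(w := g)) (Suc n) w - (C(w := g)) w = descending_sum k C (Suc n) w - C w"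
      by (rule descending_sum_cong_longer[OF _ w]) (use k in auto)
    then have "(1 - cx k * cy (w k)) * g = (1 - cx k * cy (w k)) * C w"
      using g rec[OF w k] unfolding fun_upd_same by algebra
    then show ?thesis using cx_cy_ne_1[of k "w k"] by simp
  qed
  \<comment> \<open>The case \<open>i > k\<close>, for any ascent \<open>j\<close> after \<open>k\<close>.\<close>
  have later: "C w = mu_rat j (C (w \<circ> transpose j (Suc j)))" if j: "k < j" "j < n" "w j < w (Suc j)" for j
  proof -
    let ?s = "transpose j (Suc j)"
    define v where "v = w \<circ> ?s"
    define g where "g = mu_rat j (C v)"
    have j': "j \<in> {1..<n}" using j by simp
    have v: "v permutes {1..n}" unfolding v_def by (rule permutes_transpose_Suc[OF w j'])
    have vs: "v \<circ> ?s = w" by (simp add: v_def comp_assoc)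
    have vj: "v (Suc j) < v j" using j by (simp add: v_def)
    have lv: "len v = len w + 1" unfolding v_def by (rule len_ascent[OF w j' j(3)])
    have vk: "v k = w k" "maximal_below n k v"
      using k j by (auto simp: v_def maximal_below_def transpose_def)
    have "g = mu_rat j (cx k * cy (w k) * descending_sum k C (Suc n) v)"
      unfolding g_def using rec[OF v k(1) vk(2)] k vk by simp
    also have "\<dots> = cx k * cy (w k) * mu_rat j (descending_sum k C (Suc n) v)"
      using j by (intro mu_rat_scale) (simp add: swap_rat_hom swap_rat_cx transpose_def)
    also have "mu_rat j (descending_sum k C (Suc n) v) = descending_sum k (\<lambda>z. mu_rat j (C z)) (Suc n) v"
      by (rule descending_sum_additive) (simp_all add: mu_rat_add)
    also have "\<dots> = descending_sum k (hecke j (C(w := g))) (Suc n) v"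
    proof -
      have "mu_rat j (C z) = hecke j (C(w := g)) z" if z: "z permutes {1..n}" "len v < len z" for z
      proof (cases "z (Suc j) < z j")
        case True
        have "len (z \<circ> ?s) = len z - 1" using len_descent[OF z(1) j' True] by simp
        then have "z \<circ> ?s \<noteq> w" using z lv by auto
        then show ?thesis
          using IH_descent[OF z(1) _ j' True] z lv by (simp add: hecke_descent[OF True])
      next
        case False
        have "z j \<noteq> z (Suc j)" using permutes_inj[OF z(1)] by (metis injD n_not_Suc_n)
        then have za: "z j < z (Suc j)" using False by simp
        have Cz: "C z = mu_rat j (C (z \<circ> ?s))" by (rule IH[OF z(1) _ j' za]) (use z lv in simp)
        have "mu_rat j (C z) = - C z" by (subst (1 2) Cz) (rule mu_rat_mu)
        moreover have "z \<noteq> w" using z lv by auto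
        ultimately show ?thesis by (simp add: hecke_ascent[OF za])
      qed
      then have "descending_sum k (\<lambda>z. mu_rat j (C z)) (Suc n) v - mu_rat j (C v) =
          descending_sum k (hecke j (C(w := g))) (Suc n) v - hecke j (C(w := g)) v"
        by (intro descending_sum_cong_longer[OF _ v]) (use k in auto)
      moreover have "hecke j (C(w := g)) v = mu_rat j (C v)"
        by (simp add: hecke_descent[OF vj] vs g_def)
      ultimately show ?thesis by simp
    qed
    also have "\<dots> = descending_sum k (C(w := g)) (Suc n) w"
      using descending_sum_hecke[OF permutes_inj[OF v] j(1), of "Suc n"] j
      by (simp add: hecke_descent[OF vj] vs)
    finally show ?thesis using finish[of g] by (simp add: g_def v_def)
  qed
  show ?case
  proof (cases "k < i")
    case True
    then show ?thesis using later i asc by simp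
  next
    case False
    with \<open>k \<le> i\<close> have [simp]: "i = k" by simp
    let ?s = "transpose k (Suc k)"
    define v where "v = w \<circ> ?s"
    have v: "v permutes {1..n}" unfolding v_def using permutes_transpose_Suc[OF w i] by simp
    have lv: "len v = len w + 1" unfolding v_def using len_ascent[OF w i asc] by simp
    have vs: "v \<circ> ?s = w" by (simp add: v_def comp_assoc)
    have k': "k \<in> {1..<n}" "w k < w (Suc k)" using i asc by simp_all
    show ?thesis
    proof (cases "\<exists>j. k < j \<and> j < n \<and> w j < w (Suc j)")
      case True
      then obtain j where j: "k < j" "j < n" "w j < w (Suc j)" by blast
      let ?t = "transpose j (Suc j)"
      have j': "j \<in> {1..<n}" using j by simp
      have t: "w \<circ> ?t permutes {1..n}" "len (w \<circ> ?t) = len w + 1"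
        using permutes_transpose_Suc[OF w j'] len_ascent[OF w j' j(3)] by blast+
      show ?thesis
      proof (cases "j = Suc k")
        case False
        then have kj: "Suc k < j" using j by simp
        have "C w = mu_rat j (mu_rat k (C (w \<circ> ?t \<circ> ?s)))"
          using later[OF j] IH[OF t(1) _ k'(1)] t(2) kj k'(2) by (simp add: transpose_def)
        moreover have "C v = mu_rat j (C (v \<circ> ?t))"
          using IH[OF v _ j'] lv kj j by (simp add: v_def transpose_def)
        moreover have "v \<circ> ?t = w \<circ> ?t \<circ> ?s"
          using kj by (auto simp: v_def fun_eq_iff transpose_def)
        ultimately show ?thesis using mu_rat_commute[OF kj] by (simp add: v_def)
      next
        case True
        have n: "Suc k \<in> {1..<n}" using j True by simp
        have up: "w (Suc k) < w (Suc (Suc k))" using j True by simp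
        let ?t = "transpose (Suc k) (Suc (Suc k))"
        have t: "w \<circ> ?t permutes {1..n}" "len (w \<circ> ?t) = len w + 1"
          using permutes_transpose_Suc[OF w n] len_ascent[OF w n up] by blast+
        have ts: "w \<circ> ?t \<circ> ?s permutes {1..n}" "len w < len (w \<circ> ?t \<circ> ?s)"
          using permutes_transpose_Suc[OF t(1) k'(1)] len_ascent[OF t(1) k'(1)] t(2) k'(2) up
          by (simp_all add: transpose_def)
        have st: "v \<circ> ?t permutes {1..n}" "len w < len (v \<circ> ?t)"
          using permutes_transpose_Suc[OF v n] len_ascent[OF v n] lv k'(2) up
          by (simp_all add: v_def transpose_def)
        have "C w = mu_rat (Suc k) (C (w \<circ> ?t))" using later[of "Suc k"] n up by simp
        also have "C (w \<circ> ?t) = mu_rat k (C (w \<circ> ?t \<circ> ?s))"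
          using IH[OF t(1) _ k'(1)] t(2) k'(2) up by (simp add: transpose_def)
        also have "C (w \<circ> ?t \<circ> ?s) = mu_rat (Suc k) (C (w \<circ> ?t \<circ> ?s \<circ> ?t))"
          using IH[OF ts n] k'(2) by (simp add: transpose_def)
        finally have 1: "C w = mu_rat (Suc k) (mu_rat k (mu_rat (Suc k) (C (w \<circ> ?t \<circ> ?s \<circ> ?t))))" .
        have "C v = mu_rat (Suc k) (C (v \<circ> ?t))"
          using IH[OF v _ n] lv k'(2) up by (simp add: v_def transpose_def)
        also have "C (v \<circ> ?t) = mu_rat k (C (v \<circ> ?t \<circ> ?s))"
          using IH[OF st k'(1)] up by (simp add: v_def transpose_def)
        also have "v \<circ> ?t \<circ> ?s = w \<circ> ?t \<circ> ?s \<circ> ?t"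
          by (auto simp: v_def fun_eq_iff transpose_def)
        finally have 2: "C v = mu_rat (Suc k) (mu_rat k (C (w \<circ> ?t \<circ> ?s \<circ> ?t)))" .
        show ?thesis unfolding \<open>i = k\<close> v_def[symmetric] 2 1 by (rule mu_rat_braid[symmetric])
      qed
    next
      case False
      have ne: "w (Suc j) \<noteq> w j" for j using permutes_inj[OF w] by (metis injD n_not_Suc_n)
      have step: "w (Suc j) < w j" if "k < j" "j < n" for j
        using False that ne[of j] by (meson linorder_neqE_nat)
      have dec: "w b < w a" if "k < a" "a < b" "b \<le> n" for a b
        by (rule decreasing_from[of k n w]) (use step that in auto)
      have vdec: "v c < v k" if "k < c" "c \<le> n" for c
        using dec[of "Suc k" c] that k'(2) by (cases "c = Suc k") (auto simp: v_def)
      have vk: "maximal_below n k v" using k by (auto simp: v_def maximal_below_def transpose_def)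
      \<comment> \<open>As \<open>w\<close> decreases after \<open>k\<close>, the value \<open>w (Suc k)\<close> is the largest one not used before \<open>k\<close>.\<close>
      have vk_max: "v k = n + 1 - k" by (rule maximal_below_max[OF v vk k(1) vdec])
      have vk': "maximal_below n (Suc k) v" using vk vk_max by (auto simp: maximal_below_def less_Suc_eq)
      have vSuc: "v (Suc k) = w k" by (simp add: v_def)
      \<comment> \<open>The recursion at \<open>v\<close>, moved from position \<open>Suc k\<close> to \<open>k\<close>; if \<open>w k = n - k\<close>, then \<open>v = \<omega>\<^sub>0\<close>
        and the explicit top polynomial replaces it.\<close>
      define g where "g = mu_rat k (C v)"
      have "g = cx k * cy (w k) * descending_sum (Suc k) (\<lambda>z. C z + mu_rat k (C z)) (Suc n) v"
      proof (cases "w k = n - k")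
        case False
        have "C v = cx (Suc k) * (cy (w k) * descending_sum (Suc k) C (Suc n) v)"
          using rec[OF v _ vk'] k' vSuc False by (simp add: mult.assoc)
        then have "g = cx k * (cy (w k) * descending_sum (Suc k) C (Suc n) v + mu_rat k (cy (w k) * descending_sum (Suc k) C (Suc n) v))"
          unfolding g_def by (simp only: mu_rat_cx_Suc)
        also have "mu_rat k (cy (w k) * descending_sum (Suc k) C (Suc n) v) = cy (w k) * mu_rat k (descending_sum (Suc k) C (Suc n) v)"
          by (rule mu_rat_scale) simp
        also have "cx k * (cy (w k) * descending_sum (Suc k) C (Suc n) v + \<dots>) =
            cx k * cy (w k) * (descending_sum (Suc k) C (Suc n) v + mu_rat k (descending_sum (Suc k) C (Suc n) v))"
          by (simp add: algebra_simps)
        also have "descending_sum (Suc k) C (Suc n) v + mu_rat k (descending_sum (Suc k) C (Suc n) v) =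
            descending_sum (Suc k) (\<lambda>z. C z + mu_rat k (C z)) (Suc n) v"
          by (rule descending_sum_additive[where h = "\<lambda>x. x + mu_rat k x"]) (simp_all add: mu_rat_add)
        finally show ?thesis .
      next
        case True
        have "v = w0 n"
        proof (rule ccontr)
          assume "v \<noteq> w0 n"
          then obtain m where m: "m \<in> {1..n}" "maximal_below n m v" "v m \<noteq> n + 1 - m"
            using ex_first_nonmaximal[OF v] by blast
          have "m > Suc k"
          proof (rule ccontr)
            assume "\<not> m > Suc k"
            then have "m \<le> Suc k" by simp
            then show False using m vk' vSuc True by (cases "m = Suc k") (auto simp: maximal_below_def)
          qed
          then have "v c < v m" if "m < c" "c \<le> n" for c
            using dec[of m c] that by (simp add: v_def transpose_def)
          then show False using maximal_below_max[OF v m(2,1)] m by simp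
        qed
        moreover have "\<not> covers_at (Suc k) v q" if "q < Suc n" for q
          unfolding covers_at_def \<open>v = w0 n\<close> using that by (auto simp: w0_def)
        then have "descending_sum (Suc k) F (Suc n) v = F v" for F :: "_ \<Rightarrow> xypoly fract"
          by (rule descending_sum_no_cover)
        ultimately show ?thesis
          using mu_rat_H_top[OF k'(1)] top True by (simp add: g_def)
      qed
      \<comment> \<open>All ends \<open>z\<close> keep the value \<open>n + 1 - k\<close> at \<open>k\<close>, hence have a descent there, and the induction
        hypothesis applies to \<open>z s\<^sub>k\<close>.\<close>
      also have "descending_sum (Suc k) (\<lambda>z. C z + mu_rat k (C z)) (Suc n) v =
          descending_sum (Suc k) (\<lambda>z. (C(w := g)) z + (C(w := g)) (z \<circ> ?s)) (Suc n) v"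
      proof -
        have "C z + mu_rat k (C z) = (C(w := g)) z + (C(w := g)) (z \<circ> ?s)"
          if z: "z permutes {1..n}" "len v < len z" "\<And>c. c < Suc k \<Longrightarrow> z c = v c" for z
        proof -
          have "maximal_below n k z" "z k = n + 1 - k"
            using z(3) vk vk_max by (auto simp: maximal_below_def)
          then have d: "z (Suc k) < z k" using maximal_below_less[OF z(1), of k "Suc k"] k' by simp
          have "len (z \<circ> ?s) = len z - 1" using len_descent[OF z(1) k'(1) d] by simp
          then have "z \<circ> ?s \<noteq> w" "z \<noteq> w" using z lv by auto
          then show ?thesis using IH_descent[OF z(1) _ k'(1) d] z lv by simp
        qed
        then have "descending_sum (Suc k) (\<lambda>z. C z + mu_rat k (C z)) (Suc n) v - (C v + mu_rat k (C v)) =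
          descending_sum (Suc k) (\<lambda>z. (C(w := g)) z + (C(w := g)) (z \<circ> ?s)) (Suc n) v -
            ((C(w := g)) v + (C(w := g)) (v \<circ> ?s))"
          by (intro descending_sum_cong_longer[OF _ v]) auto
        moreover have "v \<noteq> w" using lv by auto
        ultimately show ?thesis by (simp add: vs g_def)
      qed
      also have "\<dots> = descending_sum k (C(w := g)) (Suc n) w"
        unfolding v_def using dec[of "Suc k"] k' by (intro descending_sum_shift[symmetric]) auto
      finally show ?thesis using finish[of g] by (simp add: g_def v_def)
    qed
  qed
qed

section \<open>Splitting off the first cover of a climbing chain\<close>

text \<open>
  For \<open>u = \<omega>\<^sub>0\<close> there is no such position, and the value is arbitrary.
\<close>

definition first_open :: "nat \<Rightarrow> (nat \<Rightarrow> nat) \<Rightarrow> nat" where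
  "first_open n u = (LEAST k. k \<in> {1..n} \<and> u k \<noteq> n + 1 - k)"

lemma first_open_eqI:
  assumes "k \<in> {1..n}" "maximal_below n k u" "u k \<noteq> n + 1 - k"
  shows "first_open n u = k"
  unfolding first_open_def
proof (rule Least_equality)
  show "k \<le> j" if "j \<in> {1..n} \<and> u j \<noteq> n + 1 - j" for j
    using maximal_belowD[OF assms(2), of j] that by (meson atLeastAtMost_iff not_le)
qed (use assms in blast)

lemma first_open:
  assumes "u permutes {1..n}" "u \<noteq> w0 n"
  shows "first_open n u \<in> {1..n}" "maximal_below n (first_open n u) u" "u (first_open n u) \<noteq> n + 1 - first_open n u"
  using ex_first_nonmaximal[OF assms] first_open_eqI by metis+

text \<open>
  A position that carries the largest value among the remaining ones cannot be raised, so the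
  \<open>k\<close>-Bruhat order offers no cover once the first \<open>k\<close> values are in place.
\<close>

lemma no_k_cover:
  assumes u: "u permutes {1..n}" and t: "maximal_below n (Suc k) u"
  shows "\<not> k_cover n k u v"
proof
  assume "k_cover n k u v"
  then obtain a b where ab: "1 \<le> a" "a \<le> k" "k < b" "b \<le> n" "v = u \<circ> transpose a b" "len v = len u + 1"
    by (auto simp: k_cover_def)
  then have "u a < u b" using len_covers_at_iff[OF u, of a b] by (simp add: covers_at_def)
  moreover have "maximal_below n a u" "u a = n + 1 - a" using t ab by (auto simp: maximal_below_def)
  ultimately show False using maximal_below_less[OF u, of a b] ab by simp
qed

lemma k_cover_iff:
  assumes u: "u permutes {1..n}" and t: "maximal_below n k u" and k: "1 \<le> k"
  shows "k_cover n k u v \<longleftrightarrow> (\<exists>b\<le>n. covers_at k u b \<and> v = u \<circ> transpose k b)"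
proof
  assume "k_cover n k u v"
  then obtain a b where ab: "1 \<le> a" "a \<le> k" "k < b" "b \<le> n" "v = u \<circ> transpose a b" "len v = len u + 1"
    by (auto simp: k_cover_def)
  have "a = k"
  proof (rule ccontr)
    assume "a \<noteq> k"
    then have "maximal_below n (Suc a) u" using t ab by (auto simp: maximal_below_def)
    moreover have "k_cover n a u v"
      unfolding k_cover_def using ab by (intro exI[of _ a] exI[of _ b]) auto
    ultimately show False using no_k_cover[OF u] by blast
  qed
  then show "\<exists>b\<le>n. covers_at k u b \<and> v = u \<circ> transpose k b"
    using ab len_covers_at_iff[OF u, of a b] by auto
next
  assume "\<exists>b\<le>n. covers_at k u b \<and> v = u \<circ> transpose k b"
  then obtain b where b: "b \<le> n" "covers_at k u b" "v = u \<circ> transpose k b" by blast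
  then have "k < b" by (simp add: covers_at_def)
  then have "len v = len u + 1" using len_covers_at_iff[OF u, of k b] b k by simp
  then show "k_cover n k u v"
    unfolding k_cover_def using b k \<open>k < b\<close> by (intro exI[of _ k] exI[of _ b]) auto
qed

text \<open>
  The conditions of \<open>climbing_chain\<close> on the positions \<open>p k\<close> at which the segments end, isolated so that
  \<open>p\<close> can be transformed when the first permutation of a chain is removed or added.
\<close>

definition segmented :: "nat \<Rightarrow> (nat \<Rightarrow> nat) list \<Rightarrow> (nat \<Rightarrow> nat) \<Rightarrow> bool" where
  "segmented n \<gamma> p \<longleftrightarrow> p 0 = 0 \<and> p (n - 1) = length \<gamma> - 1 \<and>
     (\<forall>k\<in>{1..<n}. p (k - 1) \<le> p k \<and>
        (\<forall>m\<in>{p (k - 1)..<p k}. k_cover n k (\<gamma> ! m) (\<gamma> ! Suc m)) \<and>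
        (\<forall>i\<in>{1..k}. (\<gamma> ! p k) i = n + 1 - i))"

lemma climbing_chain_iff:
  "climbing_chain n w \<gamma> \<longleftrightarrow> \<gamma> \<noteq> [] \<and> hd \<gamma> = w \<and> last \<gamma> = w0 n \<and> (\<exists>p. segmented n \<gamma> p)"
  by (simp add: climbing_chain_def segmented_def)

lemma segmented_maximal_below:
  "segmented n \<gamma> p \<Longrightarrow> k \<in> {1..<n} \<Longrightarrow> maximal_below n (Suc k) (\<gamma> ! p k)"
  by (auto simp: segmented_def maximal_below_def)

lemma segmented_start:
  assumes p: "segmented n (u # \<gamma>) p" and u: "u permutes {1..n}" "maximal_below n k u" and "j < k" "j < n"
  shows "p j = 0"
  using assms(4,5)
proof (induction j)
  case 0
  then show ?case using p by (simp add: segmented_def)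
next
  case (Suc j)
  then have "p j = 0" by simp
  show ?case
  proof (rule ccontr)
    assume "p (Suc j) \<noteq> 0"
    moreover have "k_cover n (Suc j) ((u # \<gamma>) ! m) ((u # \<gamma>) ! Suc m)"
      if "m \<in> {p (Suc j - 1)..<p (Suc j)}" for m
      using p Suc.prems that by (simp add: segmented_def)
    ultimately have "k_cover n (Suc j) u ((u # \<gamma>) ! 1)"
      using \<open>p j = 0\<close> by fastforce
    moreover have "maximal_below n (Suc (Suc j)) u" using u(2) Suc.prems by (auto simp: maximal_below_def)
    ultimately show False using no_k_cover[OF u(1)] by blast
  qed
qed

lemma maximal_below_transpose: "maximal_below n k u \<Longrightarrow> k < b \<Longrightarrow> maximal_below n k (u \<circ> transpose k b)"
  by (auto simp: maximal_below_def transpose_def)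

lemma climbing_chain_w0: "climbing_chain n (w0 n) \<gamma> \<longleftrightarrow> \<gamma> = [w0 n]"
proof
  assume "climbing_chain n (w0 n) \<gamma>"
  then obtain \<gamma>' p where \<gamma>: "\<gamma> = w0 n # \<gamma>'" and p: "segmented n \<gamma> p"
    unfolding climbing_chain_iff by (metis list.exhaust_sel)
  have "p (n - 1) = 0"
  proof (cases "n = 0")
    case True
    then show ?thesis using p by (simp add: segmented_def)
  next
    case False
    have "maximal_below n n (w0 n)" by (auto simp: maximal_below_def w0_def)
    then show ?thesis using segmented_start[OF p[unfolded \<gamma>] permutes_w0, of n "n - 1"] False by simp
  qed
  then show "\<gamma> = [w0 n]" using p by (simp add: \<gamma> segmented_def)
next
  assume "\<gamma> = [w0 n]"
  then show "climbing_chain n (w0 n) \<gamma>"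
    unfolding climbing_chain_iff by (auto simp: segmented_def w0_def intro!: exI[of _ "\<lambda>_. 0"])
qed

lemma climbing_chains_w0: "{\<gamma>. climbing_chain n (w0 n) \<gamma>} = {[w0 n]}"
  using climbing_chain_w0 by blast

text \<open>
  No segment before the \<open>k\<close>-th one can contain a cover, since its positions already carry their final
  values; hence the first cover lies in the \<open>k\<close>-th segment. Removing it lowers the ends of this and of all
  later segments by one and leaves the earlier ends at \<open>0\<close>.
\<close>

lemma climbing_chain_Cons:
  assumes u: "u permutes {1..n}" "u \<noteq> w0 n" and k: "k = first_open n u"
  shows "climbing_chain n u \<gamma> \<longleftrightarrow>
    (\<exists>b\<le>n. covers_at k u b \<and> (\<exists>\<gamma>'. \<gamma> = u # \<gamma>' \<and> climbing_chain n (u \<circ> transpose k b) \<gamma>'))"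
proof
  have kt: "k \<in> {1..n}" "maximal_below n k u" "u k \<noteq> n + 1 - k" unfolding k using first_open[OF u] by auto
  {
    assume "climbing_chain n u \<gamma>"
    then obtain \<gamma>' p where \<gamma>: "\<gamma> = u # \<gamma>'" and p: "segmented n (u # \<gamma>') p" and l: "last \<gamma> = w0 n"
      unfolding climbing_chain_iff by (metis list.exhaust_sel)
    have "\<gamma>' \<noteq> []" using l u by (auto simp: \<gamma>)
    \<comment> \<open>Segments before the \<open>k\<close>-th one are empty.\<close>
    have z: "p j = 0" if "j < k" for j
      using segmented_start[OF p u(1) kt(2), of j] that kt by simp
    have "k < n"
    proof (rule ccontr)
      assume "\<not> k < n"
      then have "p (n - 1) = 0" using z[of "n - 1"] kt by simp
      then show False using p \<open>\<gamma>' \<noteq> []\<close> by (simp add: segmented_def)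
    qed
    have mono: "p (j - 1) \<le> p j" if "j \<in> {1..<n}" for j using p that by (simp add: segmented_def)
    have pk: "p k > 0"
    proof (rule ccontr)
      assume "\<not> p k > 0"
      then have "maximal_below n (Suc k) u" using segmented_maximal_below[OF p, of k] kt \<open>k < n\<close> by simp
      then show False using kt by (simp add: maximal_below_def)
    qed
    have pos: "p j > 0" if "k \<le> j" "j < n" for j
      using that
    proof (induction j rule: dec_induct)
      case base
      show ?case by (rule pk)
    next
      case (step j)
      then show ?case using mono[of "Suc j"] by simp
    qed
    have cov: "k_cover n j ((u # \<gamma>') ! m) (\<gamma>' ! m)" if "j \<in> {1..<n}" "m \<in> {p (j - 1)..<p j}" for j m
    proof -
      have "k_cover n j ((u # \<gamma>') ! m) ((u # \<gamma>') ! Suc m)"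
        using p that by (simp add: segmented_def)
      then show ?thesis by simp
    qed
    have "k_cover n k u (hd \<gamma>')"
      using cov[of k 0] z[of "k - 1"] pk kt \<open>k < n\<close> \<open>\<gamma>' \<noteq> []\<close> by (simp add: hd_conv_nth)
    then obtain b where b: "b \<le> n" "covers_at k u b" "hd \<gamma>' = u \<circ> transpose k b"
      using k_cover_iff[OF u(1) kt(2)] kt by auto
    have "segmented n \<gamma>' (\<lambda>j. p j - 1)"
      unfolding segmented_def
    proof (intro conjI ballI)
      show "p 0 - 1 = 0" "p (n - 1) - 1 = length \<gamma>' - 1" using p by (simp_all add: segmented_def)
      fix j assume j: "j \<in> {1..<n}"
      show "p (j - 1) - 1 \<le> p j - 1" using mono[OF j] by simp
      show "k_cover n j (\<gamma>' ! m) (\<gamma>' ! Suc m)" if "m \<in> {p (j - 1) - 1..<p j - 1}" for m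
      proof -
        have "Suc m \<in> {p (j - 1)..<p j}" using that by auto
        then show ?thesis using cov[OF j] by fastforce
      qed
      show "(\<gamma>' ! (p j - 1)) i = n + 1 - i" if i: "i \<in> {1..j}" for i
      proof (cases "j < k")
        case True
        then show ?thesis
          using maximal_belowD[OF maximal_below_transpose[OF kt(2)], of b i] z[of j] i b \<open>\<gamma>' \<noteq> []\<close>
          by (simp add: hd_conv_nth covers_at_def)
      next
        case False
        then have "\<gamma>' ! (p j - 1) = (u # \<gamma>') ! p j" using pos[of j] j by simp
        then show ?thesis using segmented_maximal_below[OF p j] i by (simp add: maximal_below_def)
      qed
    qed
    then show "\<exists>b\<le>n. covers_at k u b \<and> (\<exists>\<gamma>'. \<gamma> = u # \<gamma>' \<and> climbing_chain n (u \<circ> transpose k b) \<gamma>')"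
      using b l \<open>\<gamma>' \<noteq> []\<close> unfolding climbing_chain_iff \<gamma> by auto
  next
    assume "\<exists>b\<le>n. covers_at k u b \<and> (\<exists>\<gamma>'. \<gamma> = u # \<gamma>' \<and> climbing_chain n (u \<circ> transpose k b) \<gamma>')"
    then obtain b \<gamma>' p where b: "b \<le> n" "covers_at k u b" and \<gamma>: "\<gamma> = u # \<gamma>'"
      and \<gamma>': "\<gamma>' \<noteq> []" "hd \<gamma>' = u \<circ> transpose k b" "last \<gamma>' = w0 n" and p: "segmented n \<gamma>' p"
      unfolding climbing_chain_iff by auto
    have kb: "k < b" using b by (simp add: covers_at_def)
    have "transpose k b permutes {1..n}" using kt kb b by (intro permutes_swap_id) auto
    then have v: "hd \<gamma>' permutes {1..n}" "maximal_below n k (hd \<gamma>')"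
      unfolding \<gamma>' using permutes_compose[OF _ u(1)] maximal_below_transpose[OF kt(2) kb] by blast+
    have z: "p j = 0" if "j < k" for j
      using segmented_start[of n "hd \<gamma>'" "tl \<gamma>'" p k j] p \<gamma>'(1) v that kt kb b by simp
    have "segmented n (u # \<gamma>') (\<lambda>j. if j < k then 0 else Suc (p j))"
      unfolding segmented_def
    proof (intro conjI ballI)
      show "(if 0 < k then 0 else Suc (p 0)) = 0" using kt by simp
      show "(if n - 1 < k then 0 else Suc (p (n - 1))) = length (u # \<gamma>') - 1"
        using p kb b \<gamma>'(1) by (auto simp: segmented_def)
      fix j assume j: "j \<in> {1..<n}"
      then show "(if j - 1 < k then 0 else Suc (p (j - 1))) \<le> (if j < k then 0 else Suc (p j))"
        using p by (auto simp: segmented_def)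
      show "k_cover n j ((u # \<gamma>') ! m) ((u # \<gamma>') ! Suc m)"
        if m: "m \<in> {if j - 1 < k then 0 else Suc (p (j - 1))..<if j < k then 0 else Suc (p j)}" for m
      proof (cases m)
        case 0
        then have "j = k" using m j by (auto split: if_splits)
        then show ?thesis
          using k_cover_iff[OF u(1) kt(2)] kt b \<gamma>' 0 by (auto simp: hd_conv_nth)
      next
        case (Suc m')
        then have "m' \<in> {p (j - 1)..<p j}" using m z[of "j - 1"] by (auto split: if_splits)
        then show ?thesis using p j Suc by (simp add: segmented_def)
      qed
      show "((u # \<gamma>') ! (if j < k then 0 else Suc (p j))) i = n + 1 - i" if "i \<in> {1..j}" for i
        using maximal_belowD[OF kt(2), of i] maximal_belowD[OF segmented_maximal_below[OF p j], of i] that by auto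
    qed
    then show "climbing_chain n u \<gamma>"
      unfolding climbing_chain_iff \<gamma> using \<gamma>' by auto
  }
qed

lemma moved_transpose: "a < b \<Longrightarrow> moved (transpose a b) = (a, b)"
proof -
  assume "a < b"
  have "c = a \<and> d = b" if "c < d" "transpose a b = transpose c d" for c d
  proof -
    have "transpose c d a = b" using that(2) by (metis transpose_apply_first)
    moreover have "transpose c d b = a" using that(2) by (metis transpose_apply_second)
    ultimately show ?thesis using that(1) \<open>a < b\<close> by (auto simp: transpose_def split: if_splits)
  qed
  note uniq = this
  show ?thesis
    unfolding moved_def
  proof (rule the_equality)
    fix x assume "case x of (c, d) \<Rightarrow> c < d \<and> transpose a b = transpose c d"
    then obtain c d where "x = (c, d)" "c < d" "transpose a b = transpose c d" by (cases x) simp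
    then show "x = (a, b)" using uniq by blast
  qed (simp add: \<open>a < b\<close>)
qed

lemma cover_label:
  assumes "u permutes {1..n}" "a < b"
  shows "label (u # (u \<circ> transpose a b) # \<gamma>) 0 = (a, b)"
proof -
  have "inv u \<circ> (u \<circ> transpose a b) = transpose a b"
    using permutes_inv_o(2)[OF assms(1)] by (simp flip: comp_assoc)
  then show ?thesis using moved_transpose[OF assms(2)] by (simp add: label_def del: o_apply)
qed

lemma cover_value_label:
  assumes u: "u permutes {1..n}" and ab: "u a < u b"
  shows "value_label (u # (u \<circ> transpose a b) # \<gamma>) 0 = (u a, u b)"
proof -
  have "u \<circ> transpose a b \<circ> inv u = transpose (u a) (u b)"
  proof
    fix x
    obtain y where "x = u y" using permutes_surj[OF u] by blast
    then show "(u \<circ> transpose a b \<circ> inv u) x = transpose (u a) (u b) x"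
      using permutes_inj[OF u] by (auto simp: transpose_def inj_eq)
  qed
  then show ?thesis using moved_transpose[OF ab] by (simp add: value_label_def del: o_apply)
qed

lemma label_Cons [simp]: "label (u # \<gamma>) (Suc m) = label \<gamma> m"
  and value_label_Cons [simp]: "value_label (u # \<gamma>) (Suc m) = value_label \<gamma> m"
  by (simp_all add: label_def value_label_def)

section \<open>Summation over the markings\<close>

text \<open>
  The covers that every marking contains. The parameter \<open>p\<close> records the label \<open>(k, p)\<close> of a
  cover preceding the chain in the same segment, with \<open>p = 0\<close> if there is none: this is what remains
  of the marking condition when the first cover of a longer chain is removed.
\<close>

definition forced :: "nat \<Rightarrow> (nat \<Rightarrow> nat) list \<Rightarrow> nat \<Rightarrow> bool" where
  "forced p \<gamma> m \<longleftrightarrow> (m = 0 \<and> snd (label \<gamma> 0) < p) \<or>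
    (\<exists>m' k i j. m = Suc m' \<and> label \<gamma> m' = (k, i) \<and> label \<gamma> m = (k, j) \<and> i > j)"

definition cover_weight :: "(nat \<Rightarrow> nat) list \<Rightarrow> nat \<Rightarrow> xypoly fract" where
  "cover_weight \<gamma> m = 1 - cx (fst (label \<gamma> m)) * cy (fst (value_label \<gamma> m))"

definition chain_weight :: "nat \<Rightarrow> (nat \<Rightarrow> nat) list \<Rightarrow> xypoly fract" where
  "chain_weight p \<gamma> =
    (\<Prod>m<num_covers \<gamma>. inverse (cover_weight \<gamma> m) - (if forced p \<gamma> m then 0 else 1))"

text \<open>
  Expanding the product over all covers gives a sum over sets of covers. A set that misses a forced
  cover contributes zero, because the second summand of its factor vanishes; the others are the markings.
\<close>

lemma sum_markings:
  "(\<Sum>M | H_marking \<gamma> M. (-1) ^ (num_covers \<gamma> - card M) * (t / ratfun (mu_weight \<gamma> M))) =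
    t * chain_weight 0 \<gamma>"
proof -
  define N where "N = {..<num_covers \<gamma>}"
  define g where "g m = (if forced 0 \<gamma> m then 0 else (-1 :: xypoly fract))" for m
  have fin: "finite N" "finite (Pow N)" by (simp_all add: N_def)
  have mark: "H_marking \<gamma> M \<longleftrightarrow> M \<subseteq> N \<and> (\<forall>m\<in>N - M. \<not> forced 0 \<gamma> m)" for M
  proof -
    have forced_Suc: "forced 0 \<gamma> (Suc m) \<longleftrightarrow>
        (\<exists>k i j. label \<gamma> m = (k, i) \<and> label \<gamma> (Suc m) = (k, j) \<and> i > j)" for m
      by (simp add: forced_def)
    have "H_marking \<gamma> M \<longleftrightarrow> M \<subseteq> N \<and> (\<forall>m. Suc m \<in> N \<longrightarrow> forced 0 \<gamma> (Suc m) \<longrightarrow> Suc m \<in> M)"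
      unfolding H_marking_def forced_Suc N_def lessThan_iff by blast
    moreover have "\<not> forced 0 \<gamma> 0" by (simp add: forced_def)
    ultimately show ?thesis by (metis DiffE DiffI not0_implies_Suc)
  qed
  have "chain_weight 0 \<gamma> = (\<Prod>m\<in>N. inverse (cover_weight \<gamma> m) + g m)"
    unfolding chain_weight_def N_def g_def by (intro prod.cong) auto
  also have "\<dots> = (\<Sum>M\<in>Pow N. (\<Prod>m\<in>M. inverse (cover_weight \<gamma> m)) * prod g (N - M))"
    by (rule prod_add[OF fin(1)])
  also have "\<dots> = (\<Sum>M | H_marking \<gamma> M. (\<Prod>m\<in>M. inverse (cover_weight \<gamma> m)) * prod g (N - M))"
  proof (rule sum.mono_neutral_right[OF fin(2)])
    show "{M. H_marking \<gamma> M} \<subseteq> Pow N" by (auto simp: mark)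
    show "\<forall>M\<in>Pow N - {M. H_marking \<gamma> M}. (\<Prod>m\<in>M. inverse (cover_weight \<gamma> m)) * prod g (N - M) = 0"
    proof
      fix M assume "M \<in> Pow N - {M. H_marking \<gamma> M}"
      then have "\<exists>m\<in>N - M. g m = 0" by (auto simp: mark g_def)
      then have "prod g (N - M) = 0" using fin by (intro prod_zero) auto
      then show "(\<Prod>m\<in>M. inverse (cover_weight \<gamma> m)) * prod g (N - M) = 0" by simp
    qed
  qed
  also have "\<dots> = (\<Sum>M | H_marking \<gamma> M. (-1) ^ (num_covers \<gamma> - card M) / ratfun (mu_weight \<gamma> M))"
  proof (rule sum.cong[OF refl])
    fix M assume "M \<in> {M. H_marking \<gamma> M}"
    then have M: "M \<subseteq> N" "\<forall>m\<in>N - M. \<not> forced 0 \<gamma> m" by (simp_all add: mark)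
    have "prod g (N - M) = (\<Prod>m\<in>N - M. -1)"
      using M(2) by (intro prod.cong) (auto simp: g_def)
    also have "\<dots> = (-1) ^ card (N - M)" by simp
    also have "card (N - M) = num_covers \<gamma> - card M"
      using M(1) by (simp add: card_Diff_subset finite_subset[OF M(1) fin(1)] N_def)
    finally have "prod g (N - M) = (-1) ^ (num_covers \<gamma> - card M)" .
    moreover have "ratfun (mu_weight \<gamma> M) = (\<Prod>m\<in>M. cover_weight \<gamma> m)"
      unfolding mu_weight_def ratfun_prod cover_weight_def Let_def ratfun_weight ..
    moreover have "(\<Prod>m\<in>M. inverse (cover_weight \<gamma> m)) = inverse (prod (cover_weight \<gamma>) M)"
      using prod_inversef[of "cover_weight \<gamma>" M] by (simp add: comp_def)
    ultimately show "(\<Prod>m\<in>M. inverse (cover_weight \<gamma> m)) * prod g (N - M) =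
        (-1) ^ (num_covers \<gamma> - card M) / ratfun (mu_weight \<gamma> M)"
      by (simp add: divide_inverse mult.commute)
  qed
  finally show ?thesis by (simp add: sum_distrib_left mult.commute)
qed

section \<open>The Monk recursion for the chain sum\<close>

definition climbing_sum :: "nat \<Rightarrow> (nat \<Rightarrow> nat) \<Rightarrow> nat \<Rightarrow> xypoly fract" where
  "climbing_sum n u p = (\<Sum>\<gamma> | climbing_chain n u \<gamma>. chain_weight p \<gamma>)"

definition cover_positions :: "nat \<Rightarrow> nat \<Rightarrow> (nat \<Rightarrow> nat) \<Rightarrow> nat set" where
  "cover_positions n k u = {b. b \<le> n \<and> covers_at k u b}"

lemma finite_cover_positions [simp]: "finite (cover_positions n k u)"
  by (simp add: cover_positions_def)

lemma cover_positions_step: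
  assumes u: "u permutes {1..n}" and k: "k \<in> {1..n}" and b: "b \<in> cover_positions n k u"
  shows "u \<circ> transpose k b permutes {1..n}" "len (u \<circ> transpose k b) = len u + 1" "k < b" "u k < u b"
proof -
  show kb: "k < b" "u k < u b" using b by (auto simp: cover_positions_def covers_at_def)
  have "b \<in> {1..n}" using b kb k by (auto simp: cover_positions_def)
  then show "u \<circ> transpose k b permutes {1..n}" "len (u \<circ> transpose k b) = len u + 1"
    using len_covers_at_iff[OF u kb(1) k] b permutes_compose[OF permutes_swap_id[OF k] u]
    by (simp_all add: cover_positions_def del: o_apply)
qed

lemma climbing_chains_eq:
  assumes "u permutes {1..n}" "u \<noteq> w0 n"
  shows "{\<gamma>. climbing_chain n u \<gamma>} =
    (\<Union>b\<in>cover_positions n (first_open n u) u. (#) u ` {\<gamma>. climbing_chain n (u \<circ> transpose (first_open n u) b) \<gamma>})"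
  using climbing_chain_Cons[OF assms refl] by (auto simp: cover_positions_def)

lemma finite_climbing_chains:
  assumes "u permutes {1..n}"
  shows "finite {\<gamma>. climbing_chain n u \<gamma>}"
  using assms
proof (induction "n * n - len u" arbitrary: u rule: less_induct)
  case less
  show ?case
  proof (cases "u = w0 n")
    case True
    then show ?thesis using climbing_chains_w0[of n] by simp
  next
    case False
    have "finite {\<gamma>. climbing_chain n (u \<circ> transpose (first_open n u) b) \<gamma>}" if "b \<in> cover_positions n (first_open n u) u" for b
    proof (rule less.hyps)
      note s = cover_positions_step[OF less.prems first_open(1)[OF less.prems False] that]
      show "u \<circ> transpose (first_open n u) b permutes {1..n}" by (rule s)
      then show "n * n - len (u \<circ> transpose (first_open n u) b) < n * n - len u"
        using s(2) len_le_square[of "u \<circ> transpose (first_open n u) b" n] by linarith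
    qed
    then show ?thesis unfolding climbing_chains_eq[OF less.prems False] by simp
  qed
qed

text \<open>
  The next cover belongs to the same segment iff the position \<open>k\<close> has not yet received its final
  value \<open>n + 1 - k\<close>; only in this case the label \<open>b\<close> is passed on.
\<close>

lemma chain_weight_Cons:
  assumes u: "u permutes {1..n}" and k: "k \<in> {1..n}" "maximal_below n k u" and b: "b \<in> cover_positions n k u"
    and \<gamma>: "climbing_chain n (u \<circ> transpose k b) \<gamma>"
  shows "chain_weight p (u # \<gamma>) =
    (inverse (1 - cx k * cy (u k)) - (if b < p then 0 else 1)) *
      chain_weight (if (u \<circ> transpose k b) k = n + 1 - k then 0 else b) \<gamma>"
proof -
  define v where "v = u \<circ> transpose k b"
  define q where "q = (if v k = n + 1 - k then 0 else b)"
  note s = cover_positions_step[OF u k(1) b, folded v_def]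
  obtain \<delta> where \<delta>: "\<gamma> = v # \<delta>"
    using \<gamma> unfolding climbing_chain_iff v_def by (metis list.exhaust_sel)
  have num: "num_covers (u # \<gamma>) = Suc (num_covers \<gamma>)" by (simp add: num_covers_def \<delta>)
  have lab: "label (u # \<gamma>) 0 = (k, b)" "value_label (u # \<gamma>) 0 = (u k, u b)"
    unfolding \<delta> v_def using cover_label[OF u s(3)] cover_value_label[where b = b, OF u s(4)] by auto
  \<comment> \<open>The first label of the remaining chain shows whether its segment is still the \<open>k\<close>-th one.\<close>
  have fst_label: "fst (label \<gamma> 0) = k \<longleftrightarrow> v k \<noteq> n + 1 - k" if "num_covers \<gamma> > 0"
  proof -
    have "v \<noteq> w0 n"
      using \<gamma> that climbing_chain_w0[of n \<gamma>] by (auto simp: v_def num_covers_def)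
    then obtain c \<delta>' where c: "covers_at (first_open n v) v c"
      and \<gamma>_eq: "\<gamma> = v # \<delta>'" and \<delta>': "climbing_chain n (v \<circ> transpose (first_open n v) c) \<delta>'"
      using climbing_chain_Cons[OF s(1) _ refl] \<gamma> unfolding v_def by blast
    then obtain \<delta>'' where "\<delta>' = (v \<circ> transpose (first_open n v) c) # \<delta>''"
      unfolding climbing_chain_iff by (metis list.exhaust_sel)
    then have "label \<gamma> 0 = (first_open n v, c)"
      unfolding \<gamma>_eq using cover_label[OF s(1)] c by (simp add: covers_at_def del: o_apply)
    moreover have "maximal_below n k v" unfolding v_def by (rule maximal_below_transpose[OF k(2) s(3)])
    then have "first_open n v = k \<longleftrightarrow> v k \<noteq> n + 1 - k"
      using first_open_eqI[OF k(1)] first_open(3)[OF s(1) \<open>v \<noteq> w0 n\<close>] by metis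
    ultimately show ?thesis by simp
  qed
  have "forced p (u # \<gamma>) 0 \<longleftrightarrow> b < p" by (simp add: forced_def lab)
  moreover have "cover_weight (u # \<gamma>) 0 = 1 - cx k * cy (u k)" by (simp add: cover_weight_def lab)
  moreover have "cover_weight (u # \<gamma>) (Suc m) = cover_weight \<gamma> m" for m by (simp add: cover_weight_def)
  moreover have "forced p (u # \<gamma>) (Suc m) \<longleftrightarrow> forced q \<gamma> m" if "m < num_covers \<gamma>" for m
  proof (cases m)
    case 0
    have "forced p (u # \<gamma>) (Suc 0) \<longleftrightarrow> fst (label \<gamma> 0) = k \<and> snd (label \<gamma> 0) < b"
      by (cases "label \<gamma> 0") (auto simp: forced_def lab)
    also have "\<dots> \<longleftrightarrow> forced q \<gamma> 0"
      using fst_label that by (auto simp: forced_def q_def)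
    finally show ?thesis by (simp add: 0)
  next
    case (Suc m')
    then show ?thesis by (auto simp: forced_def)
  qed
  ultimately show ?thesis
    unfolding chain_weight_def num prod.lessThan_Suc_shift v_def[symmetric] q_def[symmetric]
    by (intro arg_cong2[where f = "(*)"] prod.cong) auto
qed

lemma climbing_sum_w0: "climbing_sum n (w0 n) p = 1"
  unfolding climbing_sum_def climbing_chains_w0 by (simp add: chain_weight_def num_covers_def)

lemma climbing_sum_rec:
  assumes u: "u permutes {1..n}" and k: "k \<in> {1..n}" "maximal_below n k u" "u k \<noteq> n + 1 - k"
  shows "climbing_sum n u p = (\<Sum>b\<in>cover_positions n k u.
    (inverse (1 - cx k * cy (u k)) - (if b < p then 0 else 1)) *
      climbing_sum n (u \<circ> transpose k b) (if (u \<circ> transpose k b) k = n + 1 - k then 0 else b))"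
proof -
  have fp: "first_open n u = k" using first_open_eqI[OF k] .
  have ne: "u \<noteq> w0 n" using k by (auto simp: w0_def)
  let ?Ch = "\<lambda>b. {\<gamma>. climbing_chain n (u \<circ> transpose k b) \<gamma>}"
  have inj: "b = b'" if "b \<in> cover_positions n k u" "b' \<in> cover_positions n k u" "u \<circ> transpose k b = u \<circ> transpose k b'" for b b'
  proof -
    have "u b = u b'" using fun_cong[OF that(3), of k] by simp
    then show ?thesis using permutes_inj[OF u] by (simp add: inj_eq)
  qed
  have "climbing_sum n u p = (\<Sum>b\<in>cover_positions n k u. \<Sum>\<gamma>\<in>(#) u ` ?Ch b. chain_weight p \<gamma>)"
    unfolding climbing_sum_def climbing_chains_eq[OF u ne] fp
  proof (rule sum.UNION_disjoint)
    show "\<forall>b\<in>cover_positions n k u. finite ((#) u ` ?Ch b)"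
      using cover_positions_step(1)[OF u k(1)] finite_climbing_chains by blast
    show "\<forall>b\<in>cover_positions n k u. \<forall>b'\<in>cover_positions n k u. b \<noteq> b' \<longrightarrow> (#) u ` ?Ch b \<inter> (#) u ` ?Ch b' = {}"
    proof (intro ballI impI)
      fix b b' assume b: "b \<in> cover_positions n k u" "b' \<in> cover_positions n k u" "b \<noteq> b'"
      have "\<not> (climbing_chain n (u \<circ> transpose k b) \<gamma> \<and> climbing_chain n (u \<circ> transpose k b') \<gamma>)" for \<gamma>
        using inj[OF b(1,2)] b(3) unfolding climbing_chain_iff by metis
      then show "(#) u ` ?Ch b \<inter> (#) u ` ?Ch b' = {}" by auto
    qed
  qed simp
  also have "\<dots> = (\<Sum>b\<in>cover_positions n k u. \<Sum>\<gamma>\<in>?Ch b. chain_weight p (u # \<gamma>))"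
    by (simp add: sum.reindex inj_on_def)
  also have "\<dots> = (\<Sum>b\<in>cover_positions n k u. \<Sum>\<gamma>\<in>?Ch b.
      (inverse (1 - cx k * cy (u k)) - (if b < p then 0 else 1)) *
      chain_weight (if (u \<circ> transpose k b) k = n + 1 - k then 0 else b) \<gamma>)"
    by (intro sum.cong refl chain_weight_Cons[OF u k(1,2)]) simp_all
  finally show ?thesis by (simp only: climbing_sum_def sum_distrib_left)
qed

lemma descending_sum_eq_sum:
  "descending_sum k F p u = F u + (\<Sum>b | b < p \<and> covers_at k u b. descending_sum k F b (u \<circ> transpose k b))"
proof (induction p)
  case (Suc p)
  have "{b. b < Suc p \<and> covers_at k u b} =
      (if covers_at k u p then insert p {b. b < p \<and> covers_at k u b} else {b. b < p \<and> covers_at k u b})"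
    by (auto simp: less_Suc_eq)
  then show ?case using Suc by (simp add: descending_sum.simps(2) del: o_apply)
qed simp

text \<open>
  A preceding label \<open>p\<close> replaces the factor \<open>1 / (1 - X\<^sub>k Y\<^sub>a) - 1\<close> of a first cover with
  label \<open>(k, b)\<close>, \<open>b < p\<close>, by \<open>1 / (1 - X\<^sub>k Y\<^sub>a)\<close>. The difference is the sum over the chains
  after that cover, now preceded by \<open>b\<close>; iterating, one runs through the chains with decreasing labels.
\<close>

lemma descending_sum_climbing_sum:
  assumes "u permutes {1..n}" "k \<in> {1..n}" "maximal_below n k u" "p \<le> Suc n"
  shows "descending_sum k (\<lambda>z. climbing_sum n z 0) p u = climbing_sum n u (if u k = n + 1 - k then 0 else p)"
  using assms
proof (induction "n * n - len u" arbitrary: u p rule: less_induct)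
  case less
  note u = less.prems(1) and k = less.prems(2,3) and p = less.prems(4)
  show ?case
  proof (cases "u k = n + 1 - k")
    case True
    have "\<not> covers_at k u q" if "q < p" for q
      using maximal_below_less[OF u k(2) _ _ _ True, of q] that p k by (auto simp: covers_at_def)
    then show ?thesis using descending_sum_no_cover[of p k u] True by simp
  next
    case False
    let ?T = "\<lambda>b. climbing_sum n (u \<circ> transpose k b) (if (u \<circ> transpose k b) k = n + 1 - k then 0 else b)"
    have succs_p: "{b. b < p \<and> covers_at k u b} = {b \<in> cover_positions n k u. b < p}"
      using p by (auto simp: cover_positions_def)
    have IH: "descending_sum k (\<lambda>z. climbing_sum n z 0) b (u \<circ> transpose k b) = ?T b" if b: "b \<in> cover_positions n k u" for b
    proof (rule less.hyps)
      note s = cover_positions_step[OF u k(1) b]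
      show "u \<circ> transpose k b permutes {1..n}" by (rule s)
      then show "n * n - len (u \<circ> transpose k b) < n * n - len u"
        using s(2) len_le_square[of "u \<circ> transpose k b" n] by linarith
      show "maximal_below n k (u \<circ> transpose k b)" by (rule maximal_below_transpose[OF k(2) s(3)])
    qed (use k b in \<open>auto simp: cover_positions_def\<close>)
    have "climbing_sum n u p - climbing_sum n u 0 = (\<Sum>b\<in>cover_positions n k u. if b < p then ?T b else 0)"
      unfolding climbing_sum_rec[OF u k False] sum_subtractf[symmetric]
      by (intro sum.cong refl) (simp add: algebra_simps del: o_apply)
    also have "\<dots> = (\<Sum>b | b < p \<and> covers_at k u b. ?T b)"
      unfolding succs_p by (rule sum.inter_filter[symmetric]) simp
    also have "\<dots> = (\<Sum>b | b < p \<and> covers_at k u b. descending_sum k (\<lambda>z. climbing_sum n z 0) b (u \<circ> transpose k b))"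
      unfolding succs_p by (intro sum.cong refl) (simp only: mem_Collect_eq IH)
    finally have "climbing_sum n u p = descending_sum k (\<lambda>z. climbing_sum n z 0) p u"
      by (subst descending_sum_eq_sum) (simp add: algebra_simps del: o_apply)
    then show ?thesis using False by simp
  qed
qed

text \<open>
  Let \<open>T\<close> be the sum over the first covers of what follows them, and \<open>q = X\<^sub>k Y\<^sub>a\<close> with \<open>a = u k\<close>. Without a
  preceding label the sum is \<open>(1 / (1 - q) - 1) T\<close>; with a preceding label \<open>n + 1\<close>, which forces each
  first cover to be marked, it is \<open>T / (1 - q)\<close>. The ratio is \<open>q\<close>.
\<close>

lemma climbing_sum_monk:
  assumes u: "u permutes {1..n}" and k: "k \<in> {1..n}" "maximal_below n k u" "u k \<noteq> n + 1 - k"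
  shows "climbing_sum n u 0 = cx k * cy (u k) * descending_sum k (\<lambda>z. climbing_sum n z 0) (Suc n) u"
proof -
  define T where "T = (\<Sum>b\<in>cover_positions n k u.
    climbing_sum n (u \<circ> transpose k b) (if (u \<circ> transpose k b) k = n + 1 - k then 0 else b))"
  define q where "q = cx k * cy (u k)"
  have q: "1 - q \<noteq> 0" using cx_cy_ne_1 by (simp add: q_def)
  have "climbing_sum n u 0 = (inverse (1 - q) - 1) * T"
    unfolding climbing_sum_rec[OF u k] T_def sum_distrib_left q_def by (intro sum.cong refl) simp
  moreover have "climbing_sum n u (Suc n) = inverse (1 - q) * T"
    unfolding climbing_sum_rec[OF u k] T_def sum_distrib_left q_def
    by (intro sum.cong refl) (auto simp: cover_positions_def)
  moreover have "descending_sum k (\<lambda>z. climbing_sum n z 0) (Suc n) u = climbing_sum n u (Suc n)"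
    using descending_sum_climbing_sum[OF u k(1,2)] k(3) by simp
  moreover have "inverse (1 - q) - 1 = q * inverse (1 - q)" using q by (simp add: field_simps)
  ultimately show ?thesis
    unfolding q_def[symmetric] by (simp add: mult.assoc)
qed

text \<open>
  The recursion allows one to read off the letters of any reduced word of \<open>w\<^sup>-\<^sup>1 \<omega>\<^sub>0\<close> one by one, so
  the choice of the word in \<open>mu_perm\<close> does not matter.
\<close>

lemma H_poly_eq_climbing_sum:
  assumes w: "w permutes {1..n}"
  shows "ratfun (H_poly n w) = ratfun (H_top n) * climbing_sum n w 0"
proof -
  define C where "C u = ratfun (H_top n) * climbing_sum n u 0" for u
  have top: "C (w0 n) = ratfun (H_top n)" by (simp add: C_def climbing_sum_w0)
  have rec: "C u = cx k * cy (u k) * descending_sum k C (Suc n) u"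
    if "u permutes {1..n}" "k \<in> {1..n}" "maximal_below n k u" "u k \<noteq> n + 1 - k" for u k
  proof -
    have "ratfun (H_top n) * descending_sum k (\<lambda>z. climbing_sum n z 0) (Suc n) u = descending_sum k C (Suc n) u"
      unfolding C_def by (rule descending_sum_additive) (simp_all add: distrib_left)
    then show ?thesis
      unfolding C_def[of u] climbing_sum_monk[OF that] by (simp add: mult_ac)
  qed
  have w0_w0: "w0 n \<circ> w0 n = id" by (auto simp: fun_eq_iff w0_def)
  have word: "ratfun (mu_word is (H_top n)) = C (w0 n \<circ> inv (word_prod is))"
    if "set is \<subseteq> {1..<n}" "length is = len (word_prod is)" for "is"
    using that
  proof (induction "is")
    case Nil
    then show ?case by (simp add: mu_word_def top)
  next
    case (Cons i "is")
    let ?v = "word_prod is" and ?s = "transpose i (Suc i)"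
    have i: "i \<in> {1..<n}" and "is": "set is \<subseteq> {1..<n}" using Cons.prems(1) by auto
    note r = reduced_word_Cons[OF Cons.prems]
    have v: "?v permutes {1..n}" by (rule permutes_word_prod[OF "is"])
    define u where "u = w0 n \<circ> inv ?v"
    have u: "u permutes {1..n}" unfolding u_def by (rule permutes_compose[OF permutes_inv[OF v] permutes_w0])
    have in_range: "inv ?v i \<in> {1..n}" "inv ?v (Suc i) \<in> {1..n}"
      using permutes_in_image[OF permutes_inv[OF v]] i by auto
    have desc: "u (Suc i) < u i" using r(2) in_range by (auto simp: u_def w0_def)
    have eq: "w0 n \<circ> inv (word_prod (i # is)) = u \<circ> ?s"
      unfolding word_prod_simps u_def using permutes_bij[OF v]
      by (simp add: o_inv_distrib comp_assoc del: o_apply)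
    have "C (u \<circ> ?s) = mu_rat i (C (u \<circ> ?s \<circ> ?s))"
      by (rule mu_rat_of_monk_recursion[OF top rec permutes_transpose_Suc[OF u i] i]) (use desc in simp_all)
    also have "u \<circ> ?s \<circ> ?s = u" by (simp add: comp_assoc)
    also have "C u = ratfun (mu_word is (H_top n))"
      using Cons.IH[OF "is" r(1)] unfolding u_def by (rule sym)
    also have "mu_rat i \<dots> = ratfun (mu_word (i # is) (H_top n))"
      by (simp add: ratfun_mu_op mu_word_def)
    finally show ?case unfolding eq by simp
  qed
  define v where "v = inv w \<circ> w0 n"
  have v: "v permutes {1..n}" unfolding v_def by (rule permutes_compose[OF permutes_w0 permutes_inv[OF w]])
  define "is" where "is = (SOME is. reduced_word n is v)"
  have "reduced_word n is v" unfolding is_def by (rule someI_ex[OF ex_reduced_word[OF v]])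
  then have "ratfun (mu_perm n v (H_top n)) = C (w0 n \<circ> inv v)"
    using word[of "is"] by (simp add: reduced_word_def mu_perm_def is_def)
  also have "inv v = inv (w0 n) \<circ> w"
    unfolding v_def using o_inv_distrib[OF permutes_bij[OF permutes_inv[OF w]] permutes_bij[OF permutes_w0]]
      inv_inv_eq[OF permutes_bij[OF w]] by simp
  also have "inv (w0 n) = w0 n" using inv_unique_comp[OF w0_w0 w0_w0] .
  also have "w0 n \<circ> (w0 n \<circ> w) = w" by (simp add: w0_w0 flip: comp_assoc)
  finally show ?thesis unfolding H_poly_def v_def[symmetric] C_def .
qed

section \<open>The formula\<close>

theorem corollary6p20:
  fixes n :: nat and w :: "nat \<Rightarrow> nat"
  assumes "w permutes {1..n}"
  shows "ratfun (H_poly n w) =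
    (\<Sum>(\<gamma>, M) | climbing_chain n w \<gamma> \<and> H_marking \<gamma> M.
       (-1) ^ (num_covers \<gamma> - card M) * (ratfun (H_top n) / ratfun (mu_weight \<gamma> M)))"
proof -
  have "finite {M. H_marking \<gamma> M}" for \<gamma>
    by (rule finite_subset[of _ "Pow {..<num_covers \<gamma>}"]) (auto simp: H_marking_def)
  moreover have "{(\<gamma>, M). climbing_chain n w \<gamma> \<and> H_marking \<gamma> M} =
      (SIGMA \<gamma>:{\<gamma>. climbing_chain n w \<gamma>}. {M. H_marking \<gamma> M})"
    by auto
  ultimately have "(\<Sum>(\<gamma>, M) | climbing_chain n w \<gamma> \<and> H_marking \<gamma> M.
      (-1) ^ (num_covers \<gamma> - card M) * (ratfun (H_top n) / ratfun (mu_weight \<gamma> M))) =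
    (\<Sum>\<gamma> | climbing_chain n w \<gamma>. \<Sum>M | H_marking \<gamma> M.
      (-1) ^ (num_covers \<gamma> - card M) * (ratfun (H_top n) / ratfun (mu_weight \<gamma> M)))"
    using finite_climbing_chains[OF assms] by (simp add: sum.Sigma)
  also have "\<dots> = ratfun (H_top n) * climbing_sum n w 0"
    unfolding sum_markings climbing_sum_def sum_distrib_left ..
  finally show ?thesis using H_poly_eq_climbing_sum[OF assms] by simp
qed

end
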